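(* Let $K \subseteq L$ be fields and let $A \in \theta(K,L)$. Suppose that for every $a \in A$, the field $L$ contains no $n_a$th root of unity other than possibly $\pm 1$. Then $A$ is linearly independent over $K$.
   Context: For fields $K \subseteq L$, a set $A$ belongs to $\theta(K,L)$ if and only if all five of the following hold: (i) $A \subseteq L$; (ii) $|A| \geqslant 2$ ($A$ may be infinite); (iii) for every $a \in A$ there is some $n \in \mathbb{N}=\{1,2,\dots\}$ with $a^{n} \in K$, and $n_a$ denotes the minimal such $n$; (iv) $A$ is pairwise linearly independent over $K$ (every two distinct elements of $A$ are linearly independent over $K$); (v) if $\operatorname{char}(K)>0$ then $\gcd(n_a,\operatorname{char}(K))=1$ for all $a \in A$. *)

theory Defs
  imports "HOL-Algebra.Embedded_Algebras"
begin

definition ring_char :: "('a, 'b) ring_scheme \<Rightarrow> nat"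
  where "ring_char R =
    (if \<exists>n::nat. 0 < n \<and> [n] \<cdot>\<^bsub>R\<^esub> \<one>\<^bsub>R\<^esub> = \<zero>\<^bsub>R\<^esub>
     then (LEAST n::nat. 0 < n \<and> [n] \<cdot>\<^bsub>R\<^esub> \<one>\<^bsub>R\<^esub> = \<zero>\<^bsub>R\<^esub>)
     else 0)"

text \<open>
  The library's \<^const>\<open>ring.independent\<close> is a property of lists. A (possibly infinite) set is
  linearly independent over \<open>K\<close> iff each finite list of distinct elements of it is.
\<close>

definition lin_indep :: "'a set \<Rightarrow> ('a, 'b) ring_scheme \<Rightarrow> 'a set \<Rightarrow> bool"
  where "lin_indep K L A \<longleftrightarrow>
    (\<forall>Us. distinct Us \<and> set Us \<subseteq> A \<longrightarrow> ring.independent L K Us)"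

text \<open>The number $n_a$; it is meaningful only if some positive power of \<open>a\<close> lies in \<open>K\<close>.\<close>

definition min_exp :: "'a set \<Rightarrow> ('a, 'b) ring_scheme \<Rightarrow> 'a \<Rightarrow> nat"
  where "min_exp K L a = (LEAST n::nat. 0 < n \<and> a [^]\<^bsub>L\<^esub> n \<in> K)"

text \<open>The subfield \<open>K\<close> is a subset of the carrier; as a ring it is \<open>L\<lparr>carrier := K\<rparr>\<close>.\<close>

definition theta :: "'a set \<Rightarrow> ('a, 'b) ring_scheme \<Rightarrow> 'a set set"
  where "theta K L = {A.
    A \<subseteq> carrier L \<and>
    (infinite A \<or> 2 \<le> card A) \<and>
    (\<forall>a\<in>A. \<exists>n::nat. 0 < n \<and> a [^]\<^bsub>L\<^esub> n \<in> K) \<and>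
    (\<forall>a\<in>A. \<forall>b\<in>A. a \<noteq> b \<longrightarrow> lin_indep K L {a, b}) \<and>
    (0 < ring_char (L\<lparr>carrier := K\<rparr>) \<longrightarrow>
      (\<forall>a\<in>A. gcd (min_exp K L a) (ring_char (L\<lparr>carrier := K\<rparr>)) = 1))}"

end

theory Submission
  imports Defs "HOL-Algebra.Algebraic_Closure"
begin

text \<open>
  Let \<open>N\<close> be a common multiple of the exponents \<open>n\<^sub>a\<close> that occur in a linear relation; \<open>L\<close> still has no
  \<open>N\<close>-th roots of unity besides 1 and -1. For every subfield \<open>K\<close> and every \<open>b\<close> with \<open>b ^ N \<in> K\<close>, of
  degree \<open>n\<close> over \<open>K\<close>, taking norms gives \<open>b ^ n \<in> K\<close>; so if \<open>b \<notin> K\<close>, multiplication by \<open>b\<close>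
  permutes the lines spanned by the powers of \<open>b\<close> cyclically and \<open>b\<close> has trace 0.

  A vanishing sum of such elements, pairwise independent over \<open>K\<close>, is excluded by induction on its
  length, for all subfields at once. Normalise one term to 1 and let \<open>b\<close> be another term. If some
  term lies outside \<open>K(b)\<close>, group the terms by their lines over \<open>K(b)\<close>: the group sums do not vanish,
  by induction over \<open>K\<close>, and they form a shorter vanishing sum over \<open>K(b)\<close>. Otherwise all terms other
  than 1 generate the same field over \<open>K\<close>, and the trace of the sum from that field is the trace of 1,
  namely the degree, which divides \<open>N\<close> and is nonzero in \<open>L\<close>.
\<close>

section \<open>Degrees of radicals\<close>

text \<open>For a monic split polynomial,
  \<open>(\<ominus> \<one>) [^] degree p \<otimes> eval p \<zero>\<close> is the product of the
  roots with multiplicity, and each root has \<open>N\<close>-th power \<open>c\<close>. The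
  induction splits off one linear factor at a time.\<close>

lemma (in field) splitted_monic_const_term_power:
  assumes "p \<in> carrier (poly_ring R)" and "splitted p" and "p \<noteq> []" and "lead_coeff p = \<one>"
    and "c \<in> carrier R"
    and "\<And>a. a \<in> carrier R \<Longrightarrow> eval p a = \<zero> \<Longrightarrow> a [^] (N::nat) = c"
  shows "((\<ominus> \<one>) [^] degree p \<otimes> eval p \<zero>) [^] N = c [^] degree p"
  using assms
proof (induction "degree p" arbitrary: p)
  case 0
  then have "p = [\<one>]" by (cases p) auto
  then show ?case by simp
next
  case (Suc d)
  interpret UP: domain "poly_ring R"
    using univ_poly_is_domain[OF carrier_is_subring] .
  have "roots p \<noteq> {#}" using Suc.prems(2) Suc.hyps(2) unfolding splitted_def by auto
  with Suc.prems(1) obtain a where a: "a \<in> carrier R" "a \<in># roots p"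
    and lin: "[ \<one>, \<ominus> a ] \<in> carrier (poly_ring R)" and pdiv: "[ \<one>, \<ominus> a ] pdivides p"
    by blast
  then obtain q where q: "q \<in> carrier (poly_ring R)" and p: "p = [ \<one>, \<ominus> a ] \<otimes>\<^bsub>poly_ring R\<^esub> q"
    unfolding pdivides_def by blast
  have q_ne: "q \<noteq> []"
    using p Suc.prems(3) lin UP.r_null by (auto simp: univ_poly_zero)
  have pm: "p = poly_mult [ \<one>, \<ominus> a ] q" using p by (simp add: univ_poly_mult)
  have poly: "polynomial (carrier R) [ \<one>, \<ominus> a ]" "polynomial (carrier R) q"
    using lin q by (simp_all add: univ_poly_carrier)
  have setq: "set q \<subseteq> carrier R" and set_lin: "set [ \<one>, \<ominus> a ] \<subseteq> carrier R"
    using poly polynomial_incl by blast+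
  have deg: "degree p = Suc (degree q)"
    unfolding pm using poly_mult_degree_eq[OF carrier_is_subring poly] q_ne by simp
  have "lead_coeff p = \<one> \<otimes> lead_coeff q"
    unfolding pm using poly_mult_lead_coeff[OF carrier_is_subring poly] q_ne by simp
  then have lcq: "lead_coeff q = \<one>" using Suc.prems(4) setq q_ne by (cases q) auto
  have eval_p: "eval p x = (x \<ominus> a) \<otimes> eval q x" if "x \<in> carrier R" for x
    unfolding pm using eval_poly_mult[OF set_lin setq that] that a(1)
    by (simp add: a_minus_def)
  have ev_closed: "eval q x \<in> carrier R" if "x \<in> carrier R" for x
    using eval_in_carrier[OF setq that] .
  have "roots p = add_mset a (roots q)"
    using poly_mult_degree_one_monic_imp_same_roots[OF a(1) q q_ne] p by simp
  then have "splitted q" using Suc.prems(2) deg unfolding splitted_def by simp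
  moreover have "x [^] N = c" if "x \<in> carrier R" "eval q x = \<zero>" for x
    using Suc.prems(6)[OF that(1)] eval_p[OF that(1)] that a(1) by simp
  ultimately have IH: "((\<ominus> \<one>) [^] degree q \<otimes> eval q \<zero>) [^] N = c [^] degree q"
    using Suc.hyps deg q q_ne lcq assms(5) by simp
  have aN: "a [^] N = c"
    using Suc.prems(6)[OF a(1)] a eval_p[OF a(1)] ev_closed[OF a(1)]
    by (simp add: a_minus_def r_neg)
  let ?s = "(\<ominus> \<one>) [^] degree q" and ?t = "eval q \<zero>"
  have closed: "?s \<in> carrier R" "?t \<in> carrier R" using ev_closed by auto
  have "(\<ominus> \<one>) [^] degree p \<otimes> eval p \<zero> = (?s \<otimes> \<ominus> \<one>) \<otimes> (\<ominus> a \<otimes> ?t)"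
    unfolding deg using eval_p[of \<zero>] a(1) closed by (simp add: a_minus_def)
  also have "\<dots> = a \<otimes> (?s \<otimes> ?t)"
    using closed a(1) by (simp add: m_ac l_minus r_minus)
  finally show ?case
    using closed a(1) IH aN deg assms(5)
    by (simp add: nat_pow_distrib m_comm)
qed

section \<open>Binomials X^N - c and algebraicity of radicals\<close>

text \<open>Coefficient lists start with the leading coefficient, so appending
  \<open>\<ominus> c\<close> to the \<open>N\<close> entries of X^(N-1) gives X^N - c. For
  \<open>N = 0\<close> truncated subtraction would produce X - c instead.\<close>

lemma (in ring) eval_binomial:
  assumes "x \<in> carrier R" and "c \<in> carrier R" and "0 < (N::nat)"
  shows "eval (monom \<one> (N - 1) @ [\<ominus> c]) x = x [^] N \<ominus> c"
proof -
  have "set (monom \<one> (N - 1)) \<subseteq> carrier R" using monom_in_carrier by simp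
  then have "eval (monom \<one> (N - 1) @ [\<ominus> c]) x = \<one> \<otimes> x [^] (N - 1) \<otimes> x \<oplus> \<ominus> c"
    using eval_append_aux assms(1,2) eval_monom[OF one_closed assms(1)] by simp
  then show ?thesis
    using assms nat_pow_Suc[of x "N - 1"] by (simp add: a_minus_def)
qed

lemma (in ring) binomial_in_univ_poly:
  assumes "subring K R" and "\<one> \<noteq> \<zero>" and "c \<in> K"
  shows "monom \<one> m @ [\<ominus> c] \<in> carrier (K[X])"
proof -
  have "\<one> \<in> K" "\<zero> \<in> K" "\<ominus> c \<in> K" using subringE(2,3,5)[OF assms(1)] assms(3) by blast+
  then show ?thesis using assms(2) by (auto simp: monom_def univ_poly_def polynomial_def)
qed

text \<open>The element \<open>b\<close> is a root of X^N - b^N, which the minimal polynomial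
  therefore divides. The degree bound is applied later with a smaller exponent than the given one,
  in the remainder argument of \<open>radical_degree\<close>.\<close>

lemma (in field) simple_radical_algebraic:
  assumes "subfield K R" and "b \<in> carrier R" and "0 < (N::nat)" and "b [^] N \<in> K"
  shows "(algebraic over K) b" and "degree (Irr K b) \<le> N"
proof -
  define q where "q = monom \<one> (N - 1) @ [\<ominus> (b [^] N)]"
  have q: "q \<in> carrier (K[X])" and q_ne: "q \<noteq> []" and deg: "degree q = N"
    using binomial_in_univ_poly[OF subfieldE(1)[OF assms(1)] one_not_zero assms(4)] assms(3)
    by (auto simp: q_def monom_def)
  have ev: "eval q b = \<zero>"
    using eval_binomial assms(2,3) by (simp add: q_def)
  show alg: "(algebraic over K) b" using algebraicI[OF q q_ne ev] .
  show "degree (Irr K b) \<le> N"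
    using pdivides_imp_degree_le[OF subfieldE(1)[OF assms(1)] IrrE(1)[OF assms(1,2) alg] q q_ne
        Irr_minimal[OF assms(1,2) alg q ev]] deg by simp
qed

lemma (in field) degree_Irr_pos:
  assumes "subfield K R" and "b \<in> carrier R" and "(algebraic over K) b"
  shows "0 < degree (Irr K b)"
proof (rule ccontr)
  assume "\<not> 0 < degree (Irr K b)"
  moreover have "Irr K b \<noteq> []" "lead_coeff (Irr K b) = \<one>" "eval (Irr K b) b = \<zero>"
    using IrrE[OF assms] pirreducibleE(1)[OF subfieldE(1)[OF assms(1)]] by blast+
  ultimately have "Irr K b = [\<one>]" by (cases "Irr K b") auto
  then show False using \<open>eval (Irr K b) b = \<zero>\<close> assms(2) by simp
qed

text \<open>
  The norm of \<open>b\<close> is, up to sign, both the constant term of its minimal polynomial, hence in \<open>K\<close>,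
  and \<open>b\<close> raised to the degree times an \<open>N\<close>-th root of unity. That root of unity is a quotient of
  elements of the field, so it is 1 or -1.
\<close>
lemma (in field) radical_power_degree_mem:
  assumes K: "subfield K R" and b: "b \<in> carrier R" "b \<noteq> \<zero>" and N: "0 < (N::nat)" "b [^] N \<in> K"
    and roots_of_unity: "\<And>z. z \<in> carrier R \<Longrightarrow> z [^] N = \<one> \<Longrightarrow> z = \<one> \<or> z = \<ominus> \<one>"
  shows "b [^] degree (Irr K b) \<in> K"
proof -
  note sub = subringE[OF subfieldE(1)[OF K]]
  define f where "f = Irr K b"
  define c where "c = b [^] N"
  have alg: "(algebraic over K) b" using simple_radical_algebraic(1)[OF K b(1) N] .
  note irr = IrrE[OF K b(1) alg, folded f_def]
  have f_ne: "f \<noteq> []" using irr pirreducibleE(1)[OF subfieldE(1)[OF K]] by blast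
  have setfK: "set f \<subseteq> K" using irr(1) by (simp add: polynomial_incl univ_poly_carrier[symmetric])
  then have setf: "set f \<subseteq> carrier R" using sub(1) by blast
  have c_closed: "c \<in> carrier R" using b(1) by (simp add: c_def)
  define q where "q = monom \<one> (N - 1) @ [\<ominus> c]"
  have q: "q \<in> carrier (K[X])"
    using binomial_in_univ_poly[OF subfieldE(1)[OF K] one_not_zero] N(2) by (simp add: q_def c_def)
  have "eval q b = \<zero>"
    using eval_binomial b(1) N(1) by (simp add: q_def c_def)
  then have "f pdivides q" unfolding f_def using Irr_minimal[OF K b(1) alg q] by simp
  then obtain g where g: "g \<in> carrier (poly_ring R)" and qfg: "q = poly_mult f g"
    unfolding pdivides_def factor_def by (auto simp: univ_poly_mult)
  have setg: "set g \<subseteq> carrier R"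
    using g by (simp add: polynomial_incl univ_poly_carrier[symmetric])
  have f_in: "f \<in> carrier (poly_ring R)"
    using carrier_polynomial_shell[OF subfieldE(1)[OF K] irr(1)] .

  \<comment> \<open>The minimal polynomial need not split in the given field. Its roots are
    therefore multiplied in the algebraic closure, and the resulting equation is pulled back along
    the injective embedding \<open>h\<close>.\<close>
  define h where "h = (indexed_const :: 'a \<Rightarrow> (('a list \<times> nat) multiset \<Rightarrow> 'a))"
  interpret M: algebraic_closure alg_closure "indexed_const ` carrier R" using alg_closureE(1) .
  have h_hom: "h \<in> ring_hom R alg_closure" using alg_closureE(2) by (simp add: h_def)
  interpret h: ring_hom_ring R alg_closure h
    using ring_hom_ringI2[OF ring_axioms M.ring_axioms h_hom] .
  have h_inj: "inj_on h (carrier R)" unfolding h_def using indexed_const_inj_on .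

  define F where "F = map h f"
  have F_in: "F \<in> carrier (poly_ring alg_closure)"
    unfolding F_def using polynomial_hom[OF h_hom field_axioms M.field_axioms f_in] .
  have F_ne: "F \<noteq> []" using f_ne by (simp add: F_def)
  have F_lc: "lead_coeff F = \<one>\<^bsub>alg_closure\<^esub>"
    using irr(3) f_ne by (simp add: F_def hd_map)
  \<comment> \<open>Every conjugate of \<open>b\<close> is an \<open>N\<close>-th root of
    \<open>h c\<close>, because \<open>f\<close> divides X^N - c.\<close>
  have F_roots: "a [^]\<^bsub>alg_closure\<^esub> N = h c"
    if a: "a \<in> carrier alg_closure" and Fa: "M.eval F a = \<zero>\<^bsub>alg_closure\<^esub>" for a
  proof -
    have setF: "set F \<subseteq> carrier alg_closure" and setG: "set (map h g) \<subseteq> carrier alg_closure"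
      using setf setg by (auto simp: F_def)
    have "set q \<subseteq> carrier R" using c_closed by (auto simp: q_def monom_def)
    then have setQ: "set (map h q) \<subseteq> carrier alg_closure" by auto
    have "M.eval (map h q) a = M.eval (M.normalize (map h q)) a"
      using M.eval_normalize[OF setQ a] by simp
    also have "\<dots> = M.eval (M.poly_mult F (map h g)) a"
      unfolding qfg F_def using h.poly_mult_hom'[OF setf setg] by simp
    also have "\<dots> = \<zero>\<^bsub>alg_closure\<^esub>"
      using M.eval_poly_mult[OF setF setG a] Fa M.eval_in_carrier[OF setG a] by simp
    finally have 0: "M.eval (map h q) a = \<zero>\<^bsub>alg_closure\<^esub>" .
    have map_q: "map h q = M.monom \<one>\<^bsub>alg_closure\<^esub> (N - 1) @ [\<ominus>\<^bsub>alg_closure\<^esub> h c]"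
      using c_closed by (simp add: q_def monom_def M.monom_def)
    have "a [^]\<^bsub>alg_closure\<^esub> N \<ominus>\<^bsub>alg_closure\<^esub> h c = \<zero>\<^bsub>alg_closure\<^esub>"
      using 0 N(1) M.eval_binomial[OF a, of "h c"] c_closed by (simp add: map_q)
    then show ?thesis using a c_closed by simp
  qed
  define n where "n = degree f"
  \<comment> \<open>This is the norm of \<open>b\<close> from \<open>K(b)\<close> to
    \<open>K\<close>; it lies in \<open>K\<close> because the coefficients of \<open>f\<close>
    do.\<close>
  define t where "t = (\<ominus> \<one>) [^] n \<otimes> eval f \<zero>"
  have "eval f \<zero> \<in> K"
    using ring.eval_in_carrier[OF subring_is_ring[OF subfieldE(1)[OF K]], of f \<zero>] setfK sub(2)
      eval_consistent[OF subfieldE(1)[OF K]] by simp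
  moreover have "(\<ominus> \<one>) [^] n \<in> K"
    by (induction n) (use sub(3,5,6) in auto)
  ultimately have tK: "t \<in> K" unfolding t_def using sub(6) by simp
  then have t: "t \<in> carrier R" using sub(1) by blast
  have "M.splitted F" using M.roots_over_carrier[OF F_in] .
  from M.splitted_monic_const_term_power[OF F_in this F_ne F_lc _ F_roots]
  have "((\<ominus>\<^bsub>alg_closure\<^esub> \<one>\<^bsub>alg_closure\<^esub>) [^]\<^bsub>alg_closure\<^esub> n \<otimes>\<^bsub>alg_closure\<^esub>
      M.eval F \<zero>\<^bsub>alg_closure\<^esub>) [^]\<^bsub>alg_closure\<^esub> N = h c [^]\<^bsub>alg_closure\<^esub> n"
    using c_closed by (simp add: F_def n_def)
  moreover have "M.eval F \<zero>\<^bsub>alg_closure\<^esub> = h (eval f \<zero>)"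
    using h.eval_hom'[OF zero_closed setf] by (simp add: F_def)
  ultimately have "h (t [^] N) = h (c [^] n)"
    using eval_in_carrier[OF setf zero_closed] c_closed by (simp add: t_def h.hom_nat_pow)
  then have "t [^] N = c [^] n" using inj_onD[OF h_inj] t c_closed by simp
  also have "\<dots> = (b [^] n) [^] N" using b by (simp add: c_def nat_pow_pow mult.commute)
  finally have tN: "t [^] N = (b [^] n) [^] N" .
  have bn: "b [^] n \<in> Units R" using Units_pow_closed[of b n] b by (simp add: field_Units)
  define z where "z = t \<otimes> inv (b [^] n)"
  have z: "z \<in> carrier R" using t bn by (simp add: z_def)
  have "z [^] N = (b [^] n) [^] N \<otimes> (inv (b [^] n)) [^] N"
    using t bn b by (simp add: z_def nat_pow_distrib tN del: nat_pow_pow)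
  also have "\<dots> = (b [^] n \<otimes> inv (b [^] n)) [^] N"
    by (intro nat_pow_distrib[symmetric]) (use bn b in auto)
  finally have "z [^] N = \<one>" using bn by simp
  with z have "z = \<one> \<or> z = \<ominus> \<one>" using roots_of_unity by blast
  moreover have "t = z \<otimes> b [^] n" using t bn b by (simp add: z_def m_assoc)
  ultimately have "b [^] n = t \<or> b [^] n = \<ominus> t" using b by (auto simp: l_minus)
  then show ?thesis using tK sub(5) by (auto simp: n_def f_def)
qed

text \<open>With \<open>n\<close> the degree of \<open>b\<close>, both \<open>b [^] n\<close> and
  \<open>b [^] N\<close> lie in \<open>K\<close>, hence so does \<open>b [^] (N mod n)\<close>. A
  positive remainder would make \<open>b\<close> a root of a binomial of degree below
  \<open>n\<close>. Degree 1 would put \<open>b\<close> itself into \<open>K\<close>.\<close>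

lemma (in field) radical_degree:
  assumes K: "subfield K R" and b: "b \<in> carrier R" "b \<noteq> \<zero>" and N: "0 < (N::nat)" "b [^] N \<in> K"
    and roots_of_unity: "\<And>z. z \<in> carrier R \<Longrightarrow> z [^] N = \<one> \<Longrightarrow> z = \<one> \<or> z = \<ominus> \<one>"
  shows "degree (Irr K b) dvd N" and "b \<notin> K \<Longrightarrow> 1 < degree (Irr K b)"
proof -
  define n where "n = degree (Irr K b)"
  have mem: "b [^] n \<in> K"
    unfolding n_def using radical_power_degree_mem[OF K b N roots_of_unity] .
  have pos: "0 < n"
    unfolding n_def using degree_Irr_pos[OF K b(1) simple_radical_algebraic(1)[OF K b(1) N]] .
  show "1 < degree (Irr K b)" if "b \<notin> K"
  proof (rule ccontr)
    assume "\<not> 1 < degree (Irr K b)"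
    then have "n = 1" using pos by (simp add: n_def)
    then show False using mem that b(1) by simp
  qed
  show "degree (Irr K b) dvd N"
  proof (rule ccontr)
    assume "\<not> degree (Irr K b) dvd N"
    then have r: "0 < N mod n" by (simp add: n_def dvd_eq_mod_eq_0)
    have powK: "(b [^] n) [^] (m::nat) \<in> K" for m
      by (induction m) (use mem subringE(3,6)[OF subfieldE(1)[OF K]] in auto)
    let ?d = "(b [^] n) [^] (N div n)"
    have "?d \<in> Units R" using b field_Units by (intro Units_pow_closed) auto
    then have d0: "?d \<noteq> \<zero>" using field_Units by simp
    have "inv ?d \<in> K" using subfield_m_inv(1)[OF K] powK d0 by simp
    moreover have "b [^] N = ?d \<otimes> b [^] (N mod n)"
      using b(1) by (simp add: nat_pow_pow nat_pow_mult)
    then have "inv ?d \<otimes> b [^] N = b [^] (N mod n)"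
      using b(1) d0 field_Units by (simp add: m_assoc[symmetric] del: nat_pow_pow)
    ultimately have "b [^] (N mod n) \<in> K"
      using subringE(6)[OF subfieldE(1)[OF K] _ N(2)] by metis
    then have "n \<le> N mod n"
      unfolding n_def using simple_radical_algebraic(2)[OF K b(1)] r n_def by simp
    then show False using pos by (simp add: not_less[symmetric])
  qed
qed

section \<open>Traces of simple extensions\<close>

lemma (in ring) eval_eq_finsum:
  assumes "set p \<subseteq> carrier R" and "x \<in> carrier R"
  shows "eval p x = (\<Oplus>i\<in>{..<length p}. coeff p i \<otimes> x [^] i)"
  using assms(1)
proof (induction p)
  case Nil
  then show ?case by simp
next
  case (Cons a p)
  have "eval (a # p) x = a \<otimes> x [^] length p \<oplus> (\<Oplus>i\<in>{..<length p}. coeff p i \<otimes> x [^] i)"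
    using Cons by simp
  also have "(\<Oplus>i\<in>{..<length p}. coeff p i \<otimes> x [^] i)
      = (\<Oplus>i\<in>{..<length p}. coeff (a # p) i \<otimes> x [^] i)"
    using Cons assms(2) by (intro finsum_cong') auto
  finally show ?case
    using Cons assms(2) by (simp add: lessThan_Suc)
qed

text \<open>
  The coordinates of \<open>x\<close> in the basis \<open>1, b, \<dots>, b ^ (n - 1)\<close> of \<open>K(b)\<close>, where \<open>n\<close> is the degree of
  \<open>b\<close>; arbitrary for \<open>x\<close> outside \<open>K(b)\<close>.
\<close>
definition (in ring) power_coord :: "'a set \<Rightarrow> 'a \<Rightarrow> 'a \<Rightarrow> nat \<Rightarrow> 'a"
  where "power_coord K b x = (SOME k. (\<forall>i. k i \<in> K) \<and>
    x = (\<Oplus>i\<in>{..<degree (Irr K b)}. k i \<otimes> b [^] i))"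

locale algebraic_simple_extension = field R for R (structure) and K b +
  assumes K: "subfield K R" and b: "b \<in> carrier R" and alg: "(algebraic over K) b"
begin

lemmas subK = subringE[OF subfieldE(1)[OF K]]

lemma power_coord:
  assumes "x \<in> simple_extension K b"
  shows "power_coord K b x i \<in> K"
    and "x = (\<Oplus>i\<in>{..<degree (Irr K b)}. power_coord K b x i \<otimes> b [^] i)"
proof -
  let ?n = "degree (Irr K b)"
  have "x \<in> Span K (exp_base b ?n)" using assms Span_exp_base[OF K b alg] by simp
  then obtain Ks where Ks: "set Ks \<subseteq> K" "length Ks = ?n" "x = combine Ks (exp_base b ?n)"
    using Span_mem_iff_length_version[OF K exp_base_closed[OF b]] by (auto simp: exp_base_def)
  then have "x = eval Ks b" using combine_eq_eval[of Ks b] by simp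
  moreover have "set Ks \<subseteq> carrier R" using Ks(1) subK(1) by blast
  ultimately have "x = (\<Oplus>i\<in>{..<?n}. coeff Ks i \<otimes> b [^] i)"
    using eval_eq_finsum[of Ks b] b Ks(2) by simp
  \<comment> \<open>Beyond the length of \<open>Ks\<close> the coefficients are zero, so membership
    in \<open>K\<close> holds at every index and not only below the degree.\<close>
  moreover have "coeff Ks i \<in> K" for i
    using coeff_img(3)[of Ks] Ks(1) subK(2) rangeI[of "coeff Ks" i] by auto
  ultimately have "\<exists>k. (\<forall>i. k i \<in> K) \<and> x = (\<Oplus>i\<in>{..<?n}. k i \<otimes> b [^] i)"
    by (intro exI[of _ "coeff Ks"]) auto
  from someI_ex[OF this] show "power_coord K b x i \<in> K"
    and "x = (\<Oplus>i\<in>{..<degree (Irr K b)}. power_coord K b x i \<otimes> b [^] i)"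
    unfolding power_coord_def by auto
qed

lemma power_combination_eq_zeroD:
  assumes "\<And>i. k i \<in> K" and "(\<Oplus>i\<in>{..<degree (Irr K b)}. k i \<otimes> b [^] i) = \<zero>"
    and "j < degree (Irr K b)"
  shows "k j = \<zero>"
proof -
  let ?n = "degree (Irr K b)"
  \<comment> \<open>The order is reversed because coefficient lists and \<open>exp_base\<close> both
    begin with the highest power.\<close>
  define p where "p = map k (rev [0..<?n])"
  have len: "length p = ?n" by (simp add: p_def)
  have pK: "set p \<subseteq> K" using assms(1) by (auto simp: p_def)
  then have pR: "set p \<subseteq> carrier R" using subK(1) by blast
  have coeff: "coeff p i = k i" if "i < ?n" for i
  proof -
    have "?n - Suc (?n - 1 - i) = i" using that by linarith
    then show ?thesis using coeff_nth[of i p] that len by (simp add: p_def rev_nth)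
  qed
  have "eval p b = (\<Oplus>i\<in>{..<?n}. coeff p i \<otimes> b [^] i)"
    using eval_eq_finsum[OF pR b] len by simp
  also have "\<dots> = (\<Oplus>i\<in>{..<?n}. k i \<otimes> b [^] i)"
    using assms(1) b subK(1) coeff by (intro finsum_cong') auto
  finally have "combine p (exp_base b ?n) = \<zero>"
    using combine_eq_eval[of p b] len assms(2) by simp
  then have "set (take (length (exp_base b ?n)) p) \<subseteq> {\<zero>}"
    using independent_imp_trivial_combine[OF K exp_base_independent[OF K b alg] pK] by simp
  then have "set p \<subseteq> {\<zero>}" using len by (simp add: exp_base_def)
  then show ?thesis using assms(3) by (auto simp: p_def image_subset_iff)
qed

lemma simple_extension_props:
  shows "subfield (simple_extension K b) R" and "K \<subseteq> simple_extension K b"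
    and "b \<in> simple_extension K b"
  using simple_extension_is_subfield[OF K b] alg simple_extension_incl[OF subK(1) b]
    simple_extension_mem[OF subfieldE(1)[OF K] b] by auto

text \<open>Two expansions of \<open>x\<close> differ by a vanishing combination of the independent
  powers of \<open>b\<close>. Hence linearity of the coordinates can be proved by exhibiting an
  expansion, despite the choice operator in their definition.\<close>

lemma power_coord_eqI:
  assumes "\<And>i. k i \<in> K" and "x = (\<Oplus>i\<in>{..<degree (Irr K b)}. k i \<otimes> b [^] i)"
    and "x \<in> simple_extension K b" and "j < degree (Irr K b)"
  shows "power_coord K b x j = k j"
proof -
  let ?n = "degree (Irr K b)" and ?c = "power_coord K b x"
  have cl: "k i \<in> carrier R" "?c i \<in> carrier R" for i
    using assms(1) power_coord(1)[OF assms(3)] subK(1) by blast+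
  have xR: "x \<in> carrier R" unfolding assms(2) using cl b by (intro finsum_closed) auto
  have "(\<Oplus>i\<in>{..<?n}. (?c i \<ominus> k i) \<otimes> b [^] i) \<oplus> (\<Oplus>i\<in>{..<?n}. k i \<otimes> b [^] i)
      = (\<Oplus>i\<in>{..<?n}. (?c i \<ominus> k i) \<otimes> b [^] i \<oplus> k i \<otimes> b [^] i)"
    using cl b by (intro finsum_addf[symmetric]) auto
  also have "\<dots> = (\<Oplus>i\<in>{..<?n}. ?c i \<otimes> b [^] i)"
    using cl b by (intro finsum_cong') (auto simp: l_distr[symmetric] a_minus_def a_assoc l_neg)
  finally have "(\<Oplus>i\<in>{..<?n}. (?c i \<ominus> k i) \<otimes> b [^] i) \<oplus> x = x"
    using power_coord(2)[OF assms(3)] assms(2) by metis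
  moreover have "(\<Oplus>i\<in>{..<?n}. (?c i \<ominus> k i) \<otimes> b [^] i) \<in> carrier R"
    using cl b by (intro finsum_closed) auto
  ultimately have "(\<Oplus>i\<in>{..<?n}. (?c i \<ominus> k i) \<otimes> b [^] i) = \<zero>"
    using xR add.r_cancel_one by simp
  then have "?c j \<ominus> k j = \<zero>"
    using assms(1) power_coord(1)[OF assms(3)] subK(5,7) assms(4)
    by (intro power_combination_eq_zeroD[of "\<lambda>i. ?c i \<ominus> k i"]) (auto simp: a_minus_def)
  then show ?thesis using cl by simp
qed

lemma power_coord_add:
  assumes "x \<in> simple_extension K b" and "y \<in> simple_extension K b" and "j < degree (Irr K b)"
  shows "power_coord K b (x \<oplus> y) j = power_coord K b x j \<oplus> power_coord K b y j"
proof (rule power_coord_eqI)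
  let ?n = "degree (Irr K b)"
  have cl: "power_coord K b x i \<in> carrier R" "power_coord K b y i \<in> carrier R" for i
    using assms(1,2) power_coord(1) subK(1) by blast+
  show "power_coord K b x i \<oplus> power_coord K b y i \<in> K" for i
    using assms power_coord(1) subK(7) by simp
  have "x \<oplus> y = (\<Oplus>i\<in>{..<?n}. power_coord K b x i \<otimes> b [^] i) \<oplus>
      (\<Oplus>i\<in>{..<?n}. power_coord K b y i \<otimes> b [^] i)"
    using power_coord(2)[OF assms(1)] power_coord(2)[OF assms(2)] by simp
  also have "\<dots> = (\<Oplus>i\<in>{..<?n}. power_coord K b x i \<otimes> b [^] i \<oplus> power_coord K b y i \<otimes> b [^] i)"
    using cl b by (intro finsum_addf[symmetric]) auto
  also have "\<dots> = (\<Oplus>i\<in>{..<?n}. (power_coord K b x i \<oplus> power_coord K b y i) \<otimes> b [^] i)"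
    using cl b by (intro finsum_cong') (auto simp: l_distr)
  finally show "x \<oplus> y = \<dots>" .
  show "x \<oplus> y \<in> simple_extension K b"
    using assms subringE(7)[OF subfieldE(1)[OF simple_extension_props(1)]] by simp
qed (rule assms(3))

lemma power_coord_smult:
  assumes "k \<in> K" and "x \<in> simple_extension K b" and "j < degree (Irr K b)"
  shows "power_coord K b (k \<otimes> x) j = k \<otimes> power_coord K b x j"
proof (rule power_coord_eqI)
  let ?n = "degree (Irr K b)"
  have cl: "power_coord K b x i \<in> carrier R" "k \<in> carrier R" for i
    using assms(1,2) power_coord(1) subK(1) by blast+
  show "k \<otimes> power_coord K b x i \<in> K" for i
    using assms power_coord(1) subK(6) by simp
  have "k \<otimes> x = k \<otimes> (\<Oplus>i\<in>{..<?n}. power_coord K b x i \<otimes> b [^] i)"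
    using power_coord(2)[OF assms(2)] by simp
  also have "\<dots> = (\<Oplus>i\<in>{..<?n}. k \<otimes> (power_coord K b x i \<otimes> b [^] i))"
    using cl b by (intro finsum_rdistr) auto
  also have "\<dots> = (\<Oplus>i\<in>{..<?n}. (k \<otimes> power_coord K b x i) \<otimes> b [^] i)"
    using cl b by (intro finsum_cong') (auto simp: m_assoc)
  finally show "k \<otimes> x = \<dots>" .
  show "k \<otimes> x \<in> simple_extension K b"
    using assms simple_extension_props(2)
      subringE(6)[OF subfieldE(1)[OF simple_extension_props(1)]] by blast
qed (rule assms(3))

lemma power_coord_power:
  assumes "i < degree (Irr K b)" and "j < degree (Irr K b)"
  shows "power_coord K b (b [^] i) j = (if j = i then \<one> else \<zero>)"
proof (rule power_coord_eqI)
  let ?n = "degree (Irr K b)"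
  show "(if j = i then \<one> else \<zero>) \<in> K" for j using subK(2,3) by simp
  have "(\<Oplus>l\<in>{..<?n}. (if l = i then \<one> else \<zero>) \<otimes> b [^] l)
      = (\<Oplus>l\<in>{..<?n}. if i = l then b [^] l else \<zero>)"
    using b by (intro finsum_cong') auto
  also have "\<dots> = b [^] i" using finsum_singleton[of i "{..<?n}"] assms(1) b by auto
  finally show "b [^] i = (\<Oplus>l\<in>{..<?n}. (if l = i then \<one> else \<zero>) \<otimes> b [^] l)" by simp
  show "b [^] i \<in> simple_extension K b"
    using simple_extension_props(3) subringE(3,6)[OF subfieldE(1)[OF simple_extension_props(1)]]
    by (induction i) auto
qed (rule assms(2))

text \<open>Linearity in the shape needed for a change of basis between two generators of the same
  field.\<close>

lemma power_coord_finsum: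
  assumes "\<And>i. k i \<in> K" and "\<And>i. v i \<in> simple_extension K b" and "j < degree (Irr K b)"
  shows "power_coord K b (\<Oplus>i\<in>{..<(m::nat)}. k i \<otimes> v i) j
    = (\<Oplus>i\<in>{..<m}. k i \<otimes> power_coord K b (v i) j)"
proof (induction m)
  note E = simple_extension_props and subE = subringE[OF subfieldE(1)[OF simple_extension_props(1)]]
  have cl: "k i \<in> carrier R" "v i \<in> carrier R" "power_coord K b (v i) j \<in> carrier R" for i
    using assms(1,2) power_coord(1)[OF assms(2)] subK(1) subE(1) by blast+
  have kv: "k i \<otimes> v i \<in> simple_extension K b" for i
    using assms(1,2) E(2) subE(6) by blast
  {
    case 0
    \<comment> \<open>The coordinates of zero vanish by homogeneity, applied with the scalar
      \<open>\<zero>\<close>.\<close>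
    have "power_coord K b (\<zero> \<otimes> v 0) j = \<zero> \<otimes> power_coord K b (v 0) j"
      using power_coord_smult subK(2) assms(2,3) by blast
    then show ?case using cl by simp
  next
    case (Suc m)
    have "(\<Oplus>i\<in>{..<m}. k i \<otimes> v i) \<in> simple_extension K b"
      by (induction m) (use kv cl subE(2,7) in \<open>auto simp: lessThan_Suc Pi_def\<close>)
    then show ?case
      using Suc cl power_coord_add[OF kv _ assms(3)] power_coord_smult[OF assms(1,2,3)]
      by (simp add: lessThan_Suc Pi_def)
  }
qed

end

text \<open>The trace of multiplication by \<open>x\<close> on \<open>K(b)\<close> as a
  \<open>K\<close>-linear map: the sum of the diagonal entries of its matrix in the basis of powers
  of \<open>b\<close>.\<close>

definition (in ring) power_trace :: "'a set \<Rightarrow> 'a \<Rightarrow> 'a \<Rightarrow> 'a"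
  where "power_trace K b x = (\<Oplus>j\<in>{..<degree (Irr K b)}. power_coord K b (x \<otimes> b [^] j) j)"

context algebraic_simple_extension
begin

lemma power_mem_simple_extension: "b [^] (j::nat) \<in> simple_extension K b"
  using simple_extension_props(3) subringE(3,6)[OF subfieldE(1)[OF simple_extension_props(1)]]
  by (induction j) auto

lemma power_trace_summand_closed:
  assumes "x \<in> simple_extension K b"
  shows "x \<otimes> b [^] (j::nat) \<in> simple_extension K b"
    and "power_coord K b (x \<otimes> b [^] (j::nat)) i \<in> carrier R"
proof -
  show *: "x \<otimes> b [^] (j::nat) \<in> simple_extension K b"
    using assms power_mem_simple_extension
      subringE(6)[OF subfieldE(1)[OF simple_extension_props(1)]] by blast
  show "power_coord K b (x \<otimes> b [^] (j::nat)) i \<in> carrier R"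
    using power_coord(1)[OF *] subK(1) by blast
qed

lemma power_trace_add:
  assumes "x \<in> simple_extension K b" and "y \<in> simple_extension K b"
  shows "power_trace K b (x \<oplus> y) = power_trace K b x \<oplus> power_trace K b y"
proof -
  let ?n = "degree (Irr K b)"
  have cl: "x \<in> carrier R" "y \<in> carrier R"
    using assms subfieldE(3)[OF simple_extension_props(1)] by blast+
  have "power_trace K b (x \<oplus> y) = (\<Oplus>j\<in>{..<?n}. power_coord K b (x \<otimes> b [^] j) j
      \<oplus> power_coord K b (y \<otimes> b [^] j) j)"
    unfolding power_trace_def using assms cl b power_trace_summand_closed
    by (intro finsum_cong') (auto simp: l_distr power_coord_add)
  also have "\<dots> = power_trace K b x \<oplus> power_trace K b y"
    unfolding power_trace_def using assms power_trace_summand_closed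
    by (intro finsum_addf) auto
  finally show ?thesis .
qed

lemma power_trace_closed:
  assumes "x \<in> simple_extension K b"
  shows "power_trace K b x \<in> carrier R"
  unfolding power_trace_def using power_trace_summand_closed[OF assms] by (intro finsum_closed) auto

lemma power_trace_one: "power_trace K b \<one> = [degree (Irr K b)] \<cdot> \<one>"
proof -
  let ?n = "degree (Irr K b)"
  have "power_trace K b \<one> = (\<Oplus>j\<in>{..<?n}. \<one>)"
    unfolding power_trace_def using b by (intro finsum_cong') (auto simp: power_coord_power)
  then show ?thesis by (simp add: add.finprod_const add_pow_def)
qed

text \<open>Multiplication by \<open>b\<close> carries each basis power to the next one and the last
  to a \<open>K\<close>-multiple of \<open>\<one>\<close>. The diagonal of its matrix is zero, since
  for degree above 1 the last basis power is not \<open>\<one>\<close>.\<close>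

lemma power_trace_self:
  assumes "b [^] degree (Irr K b) \<in> K" and "1 < degree (Irr K b)"
  shows "power_trace K b b = \<zero>"
proof -
  let ?n = "degree (Irr K b)"
  have "power_coord K b (b \<otimes> b [^] j) j = \<zero>" if j: "j < ?n" for j
  proof (cases "Suc j = ?n")
    case False
    then have "power_coord K b (b [^] Suc j) j = \<zero>"
      using j power_coord_power[of "Suc j" j] by simp
    then show ?thesis using b nat_pow_Suc2 by simp
  next
    case True
    have "b \<otimes> b [^] j = b [^] ?n \<otimes> b [^] (0::nat)"
      using b True[symmetric] nat_pow_Suc2 by simp
    moreover have "power_coord K b (b [^] ?n \<otimes> b [^] (0::nat)) j
        = b [^] ?n \<otimes> power_coord K b (b [^] (0::nat)) j"
      using power_coord_smult[OF assms(1) power_mem_simple_extension j] .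
    moreover have "power_coord K b (b [^] (0::nat)) j = \<zero>"
      using power_coord_power[of 0 j] True assms(2) j by auto
    ultimately show ?thesis using b by simp
  qed
  then have "power_trace K b b = (\<Oplus>j\<in>{..<?n}. \<zero>)"
    unfolding power_trace_def by (intro finsum_cong') auto
  then show ?thesis by simp
qed

end

section \<open>Independence of the trace from the generator\<close>

lemma (in abelian_monoid) finsum_swap:
  assumes "finite A" and "finite B" and "\<And>i j. i \<in> A \<Longrightarrow> j \<in> B \<Longrightarrow> f i j \<in> carrier G"
  shows "(\<Oplus>i\<in>A. \<Oplus>j\<in>B. f i j) = (\<Oplus>j\<in>B. \<Oplus>i\<in>A. f i j)"
  using assms(1,3)
proof (induction A)
  case empty
  then show ?case by (simp add: finsum_zero)
next
  case (insert a A)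
  have "(\<Oplus>j\<in>B. \<Oplus>i\<in>insert a A. f i j) = (\<Oplus>j\<in>B. f a j \<oplus> (\<Oplus>i\<in>A. f i j))"
    using insert by (intro finsum_cong') auto
  also have "\<dots> = (\<Oplus>j\<in>B. f a j) \<oplus> (\<Oplus>j\<in>B. \<Oplus>i\<in>A. f i j)"
    using insert by (intro finsum_addf) auto
  finally show ?case using insert assms(2) by (simp add: Pi_def)
qed

text \<open>This is tr(UV) = tr(VU). The matrix V holds the \<open>c\<close>-coordinates of the
  products \<open>x \<otimes> b [^] j\<close>, and U holds the \<open>b\<close>-coordinates of the
  powers of \<open>c\<close>. Both traces expand into the same double sum.\<close>

lemma (in field) power_trace_basis_independent:
  assumes K: "subfield K R"
    and b: "b \<in> carrier R" "(algebraic over K) b" and c: "c \<in> carrier R" "(algebraic over K) c"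
    and E: "simple_extension K b = simple_extension K c" and x: "x \<in> simple_extension K b"
  shows "power_trace K b x = power_trace K c x"
proof -
  interpret B: algebraic_simple_extension R K b
    using field_axioms K b by (simp add: algebraic_simple_extension_def algebraic_simple_extension_axioms_def)
  interpret C: algebraic_simple_extension R K c
    using field_axioms K c by (simp add: algebraic_simple_extension_def algebraic_simple_extension_axioms_def)
  let ?m = "degree (Irr K b)" and ?n = "degree (Irr K c)"
  let ?U = "power_coord K b" and ?V = "power_coord K c"
  have subE: "subring (simple_extension K b) R" using subfieldE(1)[OF B.simple_extension_props(1)] .
  have KR: "K \<subseteq> carrier R" using subfieldE(3)[OF K] .
  have xb: "x \<otimes> b [^] j \<in> simple_extension K b" for j :: nat
    using B.power_trace_summand_closed(1)[OF x] .
  have xc: "x \<otimes> c [^] j \<in> simple_extension K c" for j :: nat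
    using C.power_trace_summand_closed(1) x E by simp
  have bj: "b [^] j \<in> simple_extension K b" "c [^] j \<in> simple_extension K b" for j :: nat
    using B.power_mem_simple_extension C.power_mem_simple_extension E by auto
  have U: "?U y i \<in> K" "?U y i \<in> carrier R" "?V y i \<in> K" "?V y i \<in> carrier R"
    if "y \<in> simple_extension K b" for y i
    using B.power_coord(1)[OF that] C.power_coord(1) that E KR by auto
  have xR: "x \<in> carrier R" using x subringE(1)[OF subE] by blast
  have 1: "?U (x \<otimes> b [^] j) j = (\<Oplus>i\<in>{..<?n}. ?V (x \<otimes> b [^] j) i \<otimes> ?U (c [^] i) j)"
    if "j < ?m" for j
  proof -
    have "x \<otimes> b [^] j = (\<Oplus>i\<in>{..<?n}. ?V (x \<otimes> b [^] j) i \<otimes> c [^] i)"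
      using C.power_coord(2) xb E by simp
    then have "?U (x \<otimes> b [^] j) j = ?U (\<Oplus>i\<in>{..<?n}. ?V (x \<otimes> b [^] j) i \<otimes> c [^] i) j"
      by (rule arg_cong)
    also have "\<dots> = (\<Oplus>i\<in>{..<?n}. ?V (x \<otimes> b [^] j) i \<otimes> ?U (c [^] i) j)"
      by (rule B.power_coord_finsum) (use U(3)[OF xb] bj(2) that in auto)
    finally show ?thesis .
  qed
  \<comment> \<open>Here \<open>c [^] i\<close> is expanded in powers of \<open>b\<close> before
    multiplying by \<open>x\<close>, so that the same products as in the previous formula
    appear.\<close>
  have 2: "?V (x \<otimes> c [^] i) i = (\<Oplus>j\<in>{..<?m}. ?V (x \<otimes> b [^] j) i \<otimes> ?U (c [^] i) j)"
    if "i < ?n" for i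
  proof -
    have "x \<otimes> c [^] i = x \<otimes> (\<Oplus>j\<in>{..<?m}. ?U (c [^] i) j \<otimes> b [^] j)"
      using B.power_coord(2)[OF bj(2)[of i]] by simp
    also have "\<dots> = (\<Oplus>j\<in>{..<?m}. x \<otimes> (?U (c [^] i) j \<otimes> b [^] j))"
      using xR U(2)[OF bj(2)] b(1) by (intro finsum_rdistr) auto
    also have "\<dots> = (\<Oplus>j\<in>{..<?m}. ?U (c [^] i) j \<otimes> (x \<otimes> b [^] j))"
      using xR U(2)[OF bj(2)] b(1) by (intro finsum_cong') (auto simp: m_lcomm)
    finally have "?V (x \<otimes> c [^] i) i = ?V (\<Oplus>j\<in>{..<?m}. ?U (c [^] i) j \<otimes> (x \<otimes> b [^] j)) i"
      by (rule arg_cong)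
    also have "\<dots> = (\<Oplus>j\<in>{..<?m}. ?U (c [^] i) j \<otimes> ?V (x \<otimes> b [^] j) i)"
      by (rule C.power_coord_finsum) (use U(1)[OF bj(2)] that xb E in auto)
    also have "\<dots> = (\<Oplus>j\<in>{..<?m}. ?V (x \<otimes> b [^] j) i \<otimes> ?U (c [^] i) j)"
      using U(2)[OF bj(2)] U(4)[OF xb] by (intro finsum_cong') (auto simp: m_comm)
    finally show ?thesis .
  qed
  have "power_trace K b x
      = (\<Oplus>j\<in>{..<?m}. \<Oplus>i\<in>{..<?n}. ?V (x \<otimes> b [^] j) i \<otimes> ?U (c [^] i) j)"
    unfolding power_trace_def using 1 U(2)[OF bj(2)] U(4)[OF xb] by (intro finsum_cong') auto
  also have "\<dots> = (\<Oplus>i\<in>{..<?n}. \<Oplus>j\<in>{..<?m}. ?V (x \<otimes> b [^] j) i \<otimes> ?U (c [^] i) j)"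
    using U(2)[OF bj(2)] U(4)[OF xb] by (intro finsum_swap) auto
  also have "\<dots> = power_trace K c x"
    unfolding power_trace_def using 2 U(4)[OF xc[folded E]]
    by (intro finsum_cong') auto
  finally show ?thesis .
qed

section \<open>Sums of radicals\<close>

lemma (in ring) finsum_mem_subring:
  assumes "subring K R" and "\<And>i. i \<in> A \<Longrightarrow> f i \<in> K"
  shows "(\<Oplus>i\<in>A. f i) \<in> K"
proof (cases "finite A")
  case True
  then show ?thesis
    using assms(2)
    by induction (use subringE(1,2,7)[OF assms(1)] in \<open>auto simp: Pi_def subset_iff\<close>)
qed (use subringE(2)[OF assms(1)] in auto)

section \<open>Inverses and quotients in a field\<close>

lemma (in field) subfield_inv_mem:
  assumes "subfield K R" and "a \<in> K" and "a \<noteq> \<zero>"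
  shows "inv a \<in> K"
  using subfield_m_inv(1)[OF assms(1)] assms(2,3) by simp

lemma (in field) inv_closed_nonzero:
  assumes "a \<in> carrier R" and "a \<noteq> \<zero>"
  shows "inv a \<in> carrier R" and "inv a \<noteq> \<zero>" and "a \<otimes> inv a = \<one>" and "inv a \<otimes> a = \<one>"
  using assms field_Units Units_inv_Units by auto

lemma (in field) inv_mult_nonzero:
  assumes "a \<in> carrier R" "a \<noteq> \<zero>" "b \<in> carrier R" "b \<noteq> \<zero>"
  shows "inv (a \<otimes> b) = inv a \<otimes> inv b"
proof (rule comm_inv_char)
  note I = inv_closed_nonzero[OF assms(1,2)] and J = inv_closed_nonzero[OF assms(3,4)]
  have "a \<otimes> b \<otimes> (inv a \<otimes> inv b) = (a \<otimes> inv a) \<otimes> (b \<otimes> inv b)"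
    using assms I(1) J(1) by (simp add: m_ac)
  then show "a \<otimes> b \<otimes> (inv a \<otimes> inv b) = \<one>" using I(3) J(3) by simp
qed (use assms inv_closed_nonzero in auto)

lemma (in field) inv_div_nonzero:
  assumes "a \<in> carrier R" "a \<noteq> \<zero>" "b \<in> carrier R" "b \<noteq> \<zero>"
  shows "inv (a \<otimes> inv b) = b \<otimes> inv a"
proof -
  have "inv (inv b) = b" using assms field_Units by (intro Units_inv_inv) auto
  then show ?thesis
    using inv_mult_nonzero[of a "inv b"] inv_closed_nonzero[of a] inv_closed_nonzero[of b] assms
    by (simp add: m_comm)
qed

lemma (in field) div_cancel_nonzero:
  assumes "a \<in> carrier R" "b \<in> carrier R" "b \<noteq> \<zero>" "c \<in> carrier R"
  shows "(a \<otimes> inv b) \<otimes> (b \<otimes> c) = a \<otimes> c"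
proof -
  note I = inv_closed_nonzero[OF assms(2,3)]
  have "(a \<otimes> inv b) \<otimes> (b \<otimes> c) = a \<otimes> (inv b \<otimes> b) \<otimes> c"
    using assms I(1) by (simp add: m_assoc)
  then show ?thesis using I(4) assms by simp
qed

lemma (in field) nat_pow_inv_nonzero:
  assumes "a \<in> carrier R" and "a \<noteq> \<zero>"
  shows "inv a [^] (n::nat) = inv (a [^] n)"
proof -
  have "a [^] n \<otimes> inv a [^] n = (a \<otimes> inv a) [^] n"
    by (intro nat_pow_distrib[symmetric]) (use assms inv_closed_nonzero in auto)
  then have "a [^] n \<otimes> inv a [^] n = \<one>" using inv_closed_nonzero[OF assms] by simp
  then show ?thesis
    using assms inv_closed_nonzero comm_inv_char[of "a [^] n" "inv a [^] n"] by simp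
qed

text \<open>
  Elements spanning pairwise distinct lines over \<open>K\<close>, all with \<open>N\<close>-th power in \<open>K\<close>. Coefficients
  of linear relations are absorbed into the elements, so that independence over \<open>K\<close> amounts to
  nonvanishing of the sums of such families.
\<close>
definition (in ring) radical_family :: "nat \<Rightarrow> 'a set \<Rightarrow> 'a set \<Rightarrow> bool"
  where "radical_family N K A \<longleftrightarrow> finite A \<and> A \<subseteq> carrier R - {\<zero>} \<and> (\<forall>a\<in>A. a [^] N \<in> K) \<and>
    (\<forall>a\<in>A. \<forall>b\<in>A. a \<noteq> b \<longrightarrow> a \<otimes> inv b \<notin> K)"

lemma (in field) radical_family_subset:
  "radical_family N K A \<Longrightarrow> B \<subseteq> A \<Longrightarrow> radical_family N K B"
  unfolding radical_family_def by (meson finite_subset subset_iff)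

text \<open>Having quotient in \<open>E\<close> is an equivalence relation on \<open>A\<close>, and
  a class sum is a representative times a nonzero element of \<open>E\<close>. So the class sums
  inherit the radical property over \<open>E\<close> and have pairwise quotients outside
  \<open>E\<close>. Passing to \<open>E\<close> thus keeps the total and leaves one term per
  class.\<close>

lemma (in field) radical_family_class_sums:
  assumes E: "subfield E R" "K \<subseteq> E" and A: "radical_family N K A"
    and nz: "\<And>a. a \<in> A \<Longrightarrow> (\<Oplus>x\<in>{x \<in> A. x \<otimes> inv a \<in> E}. x) \<noteq> \<zero>"
  obtains D where "radical_family N E D" and "(\<Oplus>x\<in>D. x) = (\<Oplus>x\<in>A. x)"
    and "card D = card ((\<lambda>a. {x \<in> A. x \<otimes> inv a \<in> E}) ` A)"
proof -
  note subE = subringE[OF subfieldE(1)[OF E(1)]]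
  define cls where "cls a = {x \<in> A. x \<otimes> inv a \<in> E}" for a
  define s where "s c = (\<Oplus>x\<in>c. x)" for c :: "'a set"
  have fin: "finite A" and AR: "\<And>a. a \<in> A \<Longrightarrow> a \<in> carrier R" "\<And>a. a \<in> A \<Longrightarrow> a \<noteq> \<zero>"
    and AN: "\<And>a. a \<in> A \<Longrightarrow> a [^] N \<in> E"
    using A E(2) unfolding radical_family_def by auto
  have invA: "inv a \<in> carrier R" "inv a \<noteq> \<zero>" "a \<otimes> inv a = \<one>" "inv a \<otimes> a = \<one>" if "a \<in> A" for a
    using inv_closed_nonzero[OF AR[OF that]] that by auto
  have mult_div: "a \<otimes> (x \<otimes> inv a) = x" if "a \<in> A" "x \<in> A" for a x
  proof -
    have "a \<otimes> (x \<otimes> inv a) = x \<otimes> (a \<otimes> inv a)" using that AR(1) invA(1) by (simp add: m_lcomm)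
    then show ?thesis using that AR(1) invA(3) by simp
  qed
  have refl: "a \<in> cls a" if "a \<in> A" for a
    using invA that subE(3) by (simp add: cls_def)
  have sym: "b \<otimes> inv a \<in> E" if "a \<otimes> inv b \<in> E" "a \<in> A" "b \<in> A" for a b
  proof -
    have "b \<otimes> inv a = inv (a \<otimes> inv b)"
      using inv_div_nonzero[of a b] that(2,3) AR by simp
    moreover have "a \<otimes> inv b \<noteq> \<zero>" using that(2,3) AR invA integral_iff by auto
    ultimately show ?thesis using subfield_inv_mem[OF E(1) that(1)] by simp
  qed
  have trans: "a \<otimes> inv c \<in> E" if "a \<otimes> inv b \<in> E" "b \<otimes> inv c \<in> E" "a \<in> A" "b \<in> A" "c \<in> A" for a b c
    using div_cancel_nonzero[of a b "inv c"] subE(6)[OF that(1,2)] that AR invA(1) by simp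
  have cls_eq: "cls a = cls b" if "a \<otimes> inv b \<in> E" "a \<in> A" "b \<in> A" for a b
    unfolding cls_def using trans sym that by blast
  have s_R: "s (cls a) \<in> carrier R" for a
    unfolding s_def cls_def using AR by (intro finsum_closed) auto
  \<comment> \<open>The cofactor \<open>e\<close> is the sum of the quotients
    \<open>x \<otimes> inv a\<close> over the class, all of which lie in \<open>E\<close>.\<close>
  have s_decomp: "\<exists>e\<in>E. e \<noteq> \<zero> \<and> s (cls a) = a \<otimes> e" if a: "a \<in> A" for a
  proof (intro bexI conjI)
    let ?e = "\<Oplus>x\<in>cls a. x \<otimes> inv a"
    show e: "?e \<in> E"
      by (rule finsum_mem_subring[OF subfieldE(1)[OF E(1)]]) (simp add: cls_def)
    have "a \<otimes> ?e = (\<Oplus>x\<in>cls a. a \<otimes> (x \<otimes> inv a))"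
      using a AR invA(1) fin by (intro finsum_rdistr) (auto simp: cls_def)
    also have "\<dots> = s (cls a)"
      unfolding s_def using a AR(1) by (intro finsum_cong') (auto simp: cls_def mult_div)
    finally show se: "s (cls a) = a \<otimes> ?e" by simp
    show "?e \<noteq> \<zero>" using se nz[OF a] AR(1)[OF a] by (auto simp: s_def cls_def)
  qed
  \<comment> \<open>Writing the class sums as \<open>a \<otimes> e\<close> and
    \<open>b \<otimes> f\<close>, the factor \<open>inv e \<otimes> f\<close> from \<open>E\<close>
    turns their quotient into that of \<open>a\<close> and \<open>b\<close>.\<close>
  have ratio: "a \<otimes> inv b \<in> E" if ab: "a \<in> A" "b \<in> A" and r: "s (cls a) \<otimes> inv (s (cls b)) \<in> E" for a b
  proof -
    obtain e f where e: "e \<in> E" "e \<noteq> \<zero>" "s (cls a) = a \<otimes> e"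
      and f: "f \<in> E" "f \<noteq> \<zero>" "s (cls b) = b \<otimes> f"
      using s_decomp ab by meson
    have eR: "e \<in> carrier R" "f \<in> carrier R" using e f subE(1) by auto
    note inve = inv_closed_nonzero[OF eR(1) e(2)] and invf = inv_closed_nonzero[OF eR(2) f(2)]
    have "inv (b \<otimes> f) = inv b \<otimes> inv f"
      using inv_mult_nonzero[of b f] ab AR eR f(2) by simp
    then have "s (cls a) \<otimes> inv (s (cls b)) \<otimes> (inv e \<otimes> f)
        = (a \<otimes> inv b) \<otimes> ((e \<otimes> inv e) \<otimes> (inv f \<otimes> f))"
      unfolding e(3) f(3) using ab AR invA(1) eR inve(1) invf(1) by (simp add: m_ac)
    also have "\<dots> = a \<otimes> inv b" using ab AR invA(1) inve(3) invf(4) by simp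
    finally show ?thesis
      using subE(6)[OF r subE(6)[OF subfield_inv_mem[OF E(1) e(1,2)] f(1)]] by simp
  qed
  define C where "C = cls ` A"
  have s_ne: "s c \<noteq> \<zero>" if "c \<in> C" for c using nz that by (auto simp: C_def s_def cls_def)
  \<comment> \<open>Equal nonzero class sums have quotient \<open>\<one>\<close>, which lies in
    \<open>E\<close>, so their classes agree. No terms are lost when the sums are collected in a
    set.\<close>
  have s_inj: "inj_on s C"
  proof (rule inj_onI)
    fix c d assume cd: "c \<in> C" "d \<in> C" "s c = s d"
    then obtain a b where ab: "a \<in> A" "b \<in> A" "c = cls a" "d = cls b" by (auto simp: C_def)
    have "s c \<otimes> inv (s d) = \<one>" using inv_closed_nonzero(3) s_R s_ne cd ab by metis
    then show "c = d" using ratio ab subE(3) cls_eq by metis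
  qed
  have "radical_family N E (s ` C)"
    unfolding radical_family_def
  proof (intro conjI ballI impI)
    show "finite (s ` C)" using fin by (simp add: C_def)
    show "s ` C \<subseteq> carrier R - {\<zero>}" using s_ne s_R by (auto simp: C_def)
  next
    fix y assume "y \<in> s ` C"
    then obtain a where a: "a \<in> A" "y = s (cls a)" by (auto simp: C_def)
    then obtain e where e: "e \<in> E" "y = a \<otimes> e" using s_decomp by metis
    have "e [^] N \<in> E" by (induction N) (use e subE(3,6) in auto)
    moreover have "y [^] N = a [^] N \<otimes> e [^] N"
      unfolding e(2) using AR a e subE(1) by (intro nat_pow_distrib) auto
    ultimately show "y [^] N \<in> E" using AN a subE(6) by simp
  next
    fix y z assume "y \<in> s ` C" "z \<in> s ` C" "y \<noteq> z"
    then obtain a b where ab: "a \<in> A" "b \<in> A" "y = s (cls a)" "z = s (cls b)"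
      by (auto simp: C_def)
    then have "cls a \<noteq> cls b" using \<open>y \<noteq> z\<close> by metis
    then show "y \<otimes> inv z \<notin> E" using ratio[OF ab(1,2)] cls_eq[OF _ ab(1,2)] ab(3,4) by metis
  qed
  moreover have "(\<Oplus>x\<in>s ` C. x) = (\<Oplus>x\<in>A. x)"
  proof -
    have "(\<Oplus>x\<in>s ` C. x) = (\<Oplus>c\<in>C. s c)"
      by (rule finsum_reindex[OF _ s_inj]) (use s_R in \<open>auto simp: C_def\<close>)
    also have "\<dots> = (\<Oplus>x\<in>\<Union>C. x)"
      unfolding s_def
    proof (intro add.finprod_Union_disjoint[symmetric])
      show "finite C" using fin by (simp add: C_def)
      show "finite c \<and> (\<forall>x\<in>c. x \<in> carrier R)" if "c \<in> C" for c
        using that fin AR by (auto simp: C_def cls_def)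
      show "pairwise disjnt C"
      proof (rule pairwiseI)
        fix c d assume "c \<in> C" "d \<in> C" "c \<noteq> d"
        moreover have "cls a = cls b" if "a \<in> A" "b \<in> A" "x \<in> cls a" "x \<in> cls b" for a b x
          using that cls_eq by (metis (no_types, lifting) cls_def mem_Collect_eq)
        ultimately show "disjnt c d" by (auto simp: C_def disjnt_iff)
      qed
    qed
    also have "\<Union>C = A" using refl by (auto simp: C_def cls_def)
    finally show ?thesis .
  qed
  moreover have "card (s ` C) = card C" using s_inj by (rule card_image)
  ultimately show ?thesis using that unfolding C_def cls_def by blast
qed

text \<open>Division by \<open>a\<close> leaves all quotients unchanged and keeps
  \<open>N\<close>-th powers in \<open>K\<close>. It turns \<open>a\<close> into
  \<open>\<one>\<close>, the only term whose trace will survive.\<close>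

lemma (in field) radical_family_normalize:
  assumes K: "subfield K R" and A: "radical_family N K A" and a: "a \<in> A"
  obtains B where "radical_family N K B" and "card B = card A" and "\<one> \<in> B"
    and "(\<Oplus>x\<in>A. x) = a \<otimes> (\<Oplus>x\<in>B. x)"
proof -
  have fin: "finite A" and AR: "\<And>a. a \<in> A \<Longrightarrow> a \<in> carrier R" "\<And>a. a \<in> A \<Longrightarrow> a \<noteq> \<zero>"
    and AN: "\<And>a. a \<in> A \<Longrightarrow> a [^] N \<in> K"
    using A unfolding radical_family_def by auto
  have invA: "inv a \<in> carrier R" "inv a \<noteq> \<zero>" "a \<otimes> inv a = \<one>" "inv a \<otimes> a = \<one>" if "a \<in> A" for a
    using inv_closed_nonzero[OF AR[OF that]] that by auto
  have mult_div: "a \<otimes> (x \<otimes> inv a) = x" if "a \<in> A" "x \<in> A" for a x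
  proof -
    have "a \<otimes> (x \<otimes> inv a) = x \<otimes> (a \<otimes> inv a)" using that AR(1) invA(1) by (simp add: m_lcomm)
    then show ?thesis using that AR(1) invA(3) by simp
  qed
  let ?B = "(\<lambda>x. x \<otimes> inv a) ` A"
  have inj: "inj_on (\<lambda>x. x \<otimes> inv a) A"
  proof (rule inj_onI)
    fix x y assume "x \<in> A" "y \<in> A" "x \<otimes> inv a = y \<otimes> inv a"
    then show "x = y" using mult_div a by metis
  qed
  have ratio: "(x \<otimes> inv a) \<otimes> inv (y \<otimes> inv a) = x \<otimes> inv y" if "x \<in> A" "y \<in> A" for x y
    using inv_div_nonzero[of y a] div_cancel_nonzero[of x a "inv y"] that a AR invA(1) by simp
  have "radical_family N K ?B"
    unfolding radical_family_def
  proof (intro conjI ballI impI)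
    show "finite ?B" using fin by simp
    show "?B \<subseteq> carrier R - {\<zero>}" using a AR invA integral_iff by auto
  next
    fix y assume "y \<in> ?B"
    then obtain x where x: "x \<in> A" "y = x \<otimes> inv a" by auto
    have "a [^] N \<noteq> \<zero>"
      using Units_pow_closed[of a N] field_Units a AR by simp
    then have "inv a [^] N \<in> K"
      using nat_pow_inv_nonzero[OF AR(1,2)[OF a]] subfield_inv_mem[OF K AN[OF a]] by simp
    moreover have "y [^] N = x [^] N \<otimes> inv a [^] N"
      unfolding x(2) using a x AR invA(1) by (intro nat_pow_distrib) auto
    ultimately show "y [^] N \<in> K" using AN x subringE(6)[OF subfieldE(1)[OF K]] by simp
  next
    fix y z assume "y \<in> ?B" "z \<in> ?B" "y \<noteq> z"
    then obtain x w where xw: "x \<in> A" "w \<in> A" "y = x \<otimes> inv a" "z = w \<otimes> inv a" "x \<noteq> w" by auto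
    then show "y \<otimes> inv z \<notin> K" using ratio A unfolding radical_family_def by auto
  qed
  moreover have "card ?B = card A" using inj by (rule card_image)
  moreover have "\<one> \<in> ?B" using invA(3)[OF a] a by force
  moreover have "a \<otimes> (\<Oplus>x\<in>?B. x) = (\<Oplus>x\<in>A. x)"
  proof -
    have "(\<Oplus>x\<in>?B. x) = (\<Oplus>x\<in>A. x \<otimes> inv a)"
      by (rule finsum_reindex[OF _ inj]) (use a AR invA(1) in auto)
    then have "a \<otimes> (\<Oplus>x\<in>?B. x) = (\<Oplus>x\<in>A. a \<otimes> (x \<otimes> inv a))"
      using fin a AR invA(1) by (simp add: finsum_rdistr Pi_def)
    also have "\<dots> = (\<Oplus>x\<in>A. x)"
      using a AR(1) by (intro finsum_cong') (auto simp: mult_div)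
    finally show ?thesis .
  qed
  ultimately show ?thesis using that by metis
qed

lemma (in field) power_trace_finsum:
  assumes "algebraic_simple_extension R K b" and "finite A" and "A \<subseteq> simple_extension K b"
    and "\<And>a. a \<in> A \<Longrightarrow> power_trace K b a = \<zero>"
  shows "power_trace K b (\<Oplus>x\<in>A. x) = \<zero>"
proof -
  interpret B: algebraic_simple_extension R K b by (rule assms(1))
  note subE = subringE[OF subfieldE(1)[OF B.simple_extension_props(1)]]
  have "power_trace K b \<zero> \<oplus> power_trace K b \<zero> = power_trace K b \<zero>"
    using B.power_trace_add[OF subE(2,2)] by simp
  then have zero: "power_trace K b \<zero> = \<zero>"
    using B.power_trace_closed[OF subE(2)] add.r_cancel_one by simp
  show ?thesis
    using assms(2-4)
  proof (induction A rule: finite_induct)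
    case empty
    then show ?case using zero by simp
  next
    case (insert a A)
    have mem: "(\<Oplus>x\<in>A. x) \<in> simple_extension K b"
      using insert by (intro finsum_mem_subring[OF subfieldE(1)[OF B.simple_extension_props(1)]]) auto
    have "(\<Oplus>x\<in>insert a A. x) = a \<oplus> (\<Oplus>x\<in>A. x)"
      using insert subE(1) by (intro finsum_insert) auto
    then show ?case using B.power_trace_add[OF _ mem] insert by simp
  qed
qed

lemma (in field) radical_family_sum_nonzero:
  assumes N: "0 < N" "[N] \<cdot> \<one> \<noteq> \<zero>"
    and roots_of_unity: "\<And>z. z \<in> carrier R \<Longrightarrow> z [^] N = \<one> \<Longrightarrow> z = \<one> \<or> z = \<ominus> \<one>"
    and "subfield K R" and "radical_family N K A" and "A \<noteq> {}"
  shows "(\<Oplus>x\<in>A. x) \<noteq> \<zero>"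
  using assms(4-6)
proof (induction "card A" arbitrary: K A rule: less_induct)
  case (less A)
  note K = less.prems(1)
  obtain a where a: "a \<in> A" using less.prems(3) by blast
  obtain B where B: "radical_family N K B" "card B = card A" "\<one> \<in> B"
    and sumA: "(\<Oplus>x\<in>A. x) = a \<otimes> (\<Oplus>x\<in>B. x)"
    using radical_family_normalize[OF K less.prems(2) a] by metis
  have fin: "finite B" and BR: "\<And>b. b \<in> B \<Longrightarrow> b \<in> carrier R" "\<And>b. b \<in> B \<Longrightarrow> b \<noteq> \<zero>"
    and BN: "\<And>b. b \<in> B \<Longrightarrow> b [^] N \<in> K"
    and indep: "\<And>b c. b \<in> B \<Longrightarrow> c \<in> B \<Longrightarrow> b \<noteq> c \<Longrightarrow> b \<otimes> inv c \<notin> K"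
    using B(1) unfolding radical_family_def by auto
  have B_notin: "b \<notin> K" if "b \<in> B" "b \<noteq> \<one>" for b
    using indep[OF that(1) B(3) that(2)] BR(1)[OF that(1)] by simp
  have IH: "(\<Oplus>x\<in>C. x) \<noteq> \<zero>"
    if "subfield F R" "radical_family N F C" "C \<noteq> {}" "card C < card B" for F C
    using less.hyps that B(2) by simp
  have ext: "algebraic_simple_extension R K b" if "b \<in> B" for b
    using K BR(1)[OF that] simple_radical_algebraic(1)[OF K _ N(1) BN] that field_axioms
    by (simp add: algebraic_simple_extension_def algebraic_simple_extension_axioms_def)
  have "(\<Oplus>x\<in>B. x) \<noteq> \<zero>"
  proof
    assume sum0: "(\<Oplus>x\<in>B. x) = \<zero>"
    \<comment> \<open>Otherwise the class sums over \<open>K(b)\<close> form a shorter family with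
      vanishing sum, against the induction hypothesis over \<open>K(b)\<close>.\<close>
    have B_sub: "B \<subseteq> simple_extension K b" if b: "b \<in> B" "b \<noteq> \<one>" for b
    proof (rule ccontr)
      assume not_sub: "\<not> B \<subseteq> simple_extension K b"
      interpret E: algebraic_simple_extension R K b using ext[OF b(1)] .
      let ?E = "simple_extension K b"
      note subE = subringE[OF subfieldE(1)[OF E.simple_extension_props(1)]]
      define cls where "cls c = {x \<in> B. x \<otimes> inv c \<in> ?E}" for c
      have cls_refl: "c \<in> cls c" if "c \<in> B" for c
        using that inv_closed_nonzero(3)[OF BR] subE(3) by (simp add: cls_def)
      have nz: "(\<Oplus>x\<in>{x \<in> B. x \<otimes> inv c \<in> ?E}. x) \<noteq> \<zero>" if c: "c \<in> B" for c
      proof -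
        \<comment> \<open>A class equal to \<open>B\<close> would contain \<open>\<one>\<close>;
          then \<open>c\<close>, and with it every term, would lie in \<open>K(b)\<close>.\<close>
        have "cls c \<noteq> B"
        proof
          assume *: "cls c = B"
          have cR: "c \<in> carrier R" "c \<noteq> \<zero>" using BR c by auto
          have "\<one> \<otimes> inv c \<in> ?E" using * B(3) by (auto simp: cls_def)
          then have "inv c \<in> ?E" using inv_closed_nonzero[OF cR] by simp
          then have "inv (inv c) \<in> ?E"
            using subfield_inv_mem[OF E.simple_extension_props(1)] inv_closed_nonzero(2)[OF cR] by simp
          then have cE: "c \<in> ?E" using cR field_Units Units_inv_inv by simp
          have "x \<in> ?E" if "x \<in> B" for x
          proof -
            have "x \<otimes> inv c \<in> ?E" using that * by (auto simp: cls_def)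
            then have "(x \<otimes> inv c) \<otimes> (c \<otimes> \<one>) \<in> ?E" using subE(6) cE cR by simp
            then show ?thesis using div_cancel_nonzero[of x c \<one>] cR BR(1)[OF that] by simp
          qed
          then show False using not_sub by blast
        qed
        moreover have sub: "cls c \<subseteq> B" by (auto simp: cls_def)
        ultimately have "card (cls c) < card B" using psubset_card_mono[OF fin] by blast
        \<comment> \<open>A class is a proper subfamily over \<open>K\<close> itself, so here the
          induction hypothesis is used without enlarging the field.\<close>
        then have "(\<Oplus>x\<in>cls c. x) \<noteq> \<zero>"
          using IH[OF K radical_family_subset[OF B(1) sub]] cls_refl[OF c] by blast
        then show ?thesis by (simp add: cls_def)
      qed
      obtain D where D: "radical_family N ?E D" "(\<Oplus>x\<in>D. x) = (\<Oplus>x\<in>B. x)"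
          "card D = card (cls ` B)"
        unfolding cls_def
        by (rule radical_family_class_sums[OF E.simple_extension_props(1,2) B(1) nz])
      \<comment> \<open>Two distinct terms share a class, which makes the number of classes strictly
        smaller than the number of terms.\<close>
      have "cls b = cls \<one>"
      proof -
        have bR: "b \<in> carrier R" "b \<noteq> \<zero>" using BR b(1) by auto
        have bE: "b \<in> ?E" "inv b \<in> ?E"
          using E.simple_extension_props subfield_inv_mem bR(2) by blast+
        have "x \<otimes> inv b \<in> ?E \<longleftrightarrow> x \<in> ?E" if "x \<in> carrier R" for x
          using div_cancel_nonzero[of x b \<one>] that bR bE subE(6)[of "x \<otimes> inv b" b] subE(6)[of x "inv b"]
          by auto
        then show ?thesis unfolding cls_def using BR(1) by auto
      qed
      then have "\<not> inj_on cls B" using b B(3) by (auto simp: inj_on_def)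
      then have "card (cls ` B) < card B"
        using card_image_le[OF fin, of cls] eq_card_imp_inj_on[OF fin, of cls] by linarith
      moreover have "D \<noteq> {}" using D(3) fin B(3) by auto
      ultimately have "(\<Oplus>x\<in>D. x) \<noteq> \<zero>"
        using IH[OF E.simple_extension_props(1) D(1)] D(3) by simp
      then show False using D(2) sum0 by simp
    qed
    have "B \<noteq> {\<one>}" using sum0 by auto
    then obtain b where b: "b \<in> B" "b \<noteq> \<one>" using B(3) by blast
    interpret E: algebraic_simple_extension R K b using ext[OF b(1)] .
    let ?E = "simple_extension K b"
    \<comment> \<open>All terms lie in \<open>K(b)\<close> and all lie in \<open>K(c)\<close>, so
      each field contains the generator of the other.\<close>
    have same: "simple_extension K c = ?E" if "c \<in> B" "c \<noteq> \<one>" for c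
    proof -
      interpret C: algebraic_simple_extension R K c using ext[OF that(1)] .
      show ?thesis
        using simple_extension_subring_incl[OF subfieldE(1)[OF E.simple_extension_props(1)]
            E.simple_extension_props(2), of c]
          simple_extension_subring_incl[OF subfieldE(1)[OF C.simple_extension_props(1)]
            C.simple_extension_props(2), of b] B_sub[OF b] B_sub[OF that] b that by blast
    qed
    \<comment> \<open>The trace of \<open>c\<close> vanishes in the basis of powers of
      \<open>c\<close>; basis independence transfers this to the powers of \<open>b\<close>.\<close>
    have trace_zero: "power_trace K b c = \<zero>" if c: "c \<in> B - {\<one>}" for c
    proof -
      have c': "c \<in> B" "c \<noteq> \<one>" using c by auto
      interpret C: algebraic_simple_extension R K c using ext[OF c'(1)] .
      have cR: "c \<in> carrier R" "c \<noteq> \<zero>" using BR c'(1) by auto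
      have "power_trace K c c = \<zero>"
        using C.power_trace_self radical_power_degree_mem[OF K cR N(1) BN[OF c'(1)] roots_of_unity]
          radical_degree(2)[OF K cR N(1) BN[OF c'(1)] roots_of_unity B_notin[OF c']] by blast
      then show ?thesis
        using power_trace_basis_independent[OF K E.b E.alg C.b C.alg same[OF c', symmetric], of c]
          B_sub[OF b] c' by auto
    qed
    have sub1: "B - {\<one>} \<subseteq> ?E" using B_sub[OF b] by blast
    have mem1: "(\<Oplus>x\<in>B - {\<one>}. x) \<in> ?E"
      by (rule finsum_mem_subring[OF subfieldE(1)[OF E.simple_extension_props(1)]]) (use sub1 in auto)
    have "(\<Oplus>x\<in>insert \<one> (B - {\<one>}). x) = \<one> \<oplus> (\<Oplus>x\<in>B - {\<one>}. x)"
      using fin BR(1) by (intro finsum_insert) auto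
    then have split: "\<zero> = \<one> \<oplus> (\<Oplus>x\<in>B - {\<one>}. x)"
      using sum0 B(3) by (simp add: insert_absorb)
    have oneE: "\<one> \<in> ?E" using B_sub[OF b] B(3) by blast
    \<comment> \<open>Taking traces of the relation leaves only the trace of \<open>\<one>\<close>,
      which is the degree as an element of the field.\<close>
    have "power_trace K b \<zero> = power_trace K b \<one> \<oplus> power_trace K b (\<Oplus>x\<in>B - {\<one>}. x)"
      using split E.power_trace_add[OF oneE mem1] by simp
    moreover have "power_trace K b (\<Oplus>x\<in>B - {\<one>}. x) = \<zero>"
      using power_trace_finsum[OF ext[OF b(1)] _ sub1 trace_zero] fin by simp
    moreover have "power_trace K b \<zero> = \<zero>"
      using power_trace_finsum[OF ext[OF b(1)], of "{}"] by simp
    ultimately have trace_one: "[degree (Irr K b)] \<cdot> \<one> = \<zero>"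
      using E.power_trace_one by simp
    \<comment> \<open>Since the degree divides \<open>N\<close>, its vanishing in the field would
      force \<open>[N] \<cdot> \<one> = \<zero>\<close>.\<close>
    have "degree (Irr K b) dvd N"
      using radical_degree(1)[OF K _ _ N(1) BN[OF b(1)] roots_of_unity] BR b(1) by blast
    then obtain k where "N = degree (Irr K b) * k" by (elim dvdE)
    then have "[N] \<cdot> \<one> = [k] \<cdot> ([degree (Irr K b)] \<cdot> \<one>)"
      by (simp add: add.nat_pow_pow)
    then show False using trace_one N(2) by simp
  qed
  moreover have "a \<in> carrier R" "a \<noteq> \<zero>" using a less.prems(2) by (auto simp: radical_family_def)
  moreover have "(\<Oplus>x\<in>B. x) \<in> carrier R" using BR(1) by (intro finsum_closed) auto
  ultimately show ?case unfolding sumA using integral_iff by simp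
qed

section \<open>Common exponents\<close>

lemma (in field) square_eq_one:
  assumes "z \<in> carrier R" and "z [^] (2::nat) = \<one>"
  shows "z = \<one> \<or> z = \<ominus> \<one>"
proof -
  have "(z \<ominus> \<one>) \<otimes> (z \<oplus> \<one>) = z \<otimes> z \<ominus> \<one>"
    using assms(1) by algebra
  also have "z \<otimes> z = \<one>" using assms by (simp add: numeral_2_eq_2)
  finally have "(z \<ominus> \<one>) \<otimes> (z \<oplus> \<one>) = \<zero>" by (simp add: r_neg a_minus_def)
  then have "z \<ominus> \<one> = \<zero> \<or> z \<oplus> \<one> = \<zero>" using assms(1) integral_iff by auto
  then show ?thesis using assms(1) minus_equality by auto
qed

text \<open>
  Write \<open>lcm m n = m n' = m' n\<close> with \<open>m'\<close>, \<open>n'\<close> coprime. If \<open>z\<close> is a root of unity of that order,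
  then \<open>z ^ n'\<close> and \<open>z ^ m'\<close> are both 1 or -1, so the order of \<open>z\<close> divides \<open>gcd (2 m') (2 n') = 2\<close>.
\<close>
lemma (in field) trivial_roots_of_unity_lcm:
  assumes m: "\<And>z. z \<in> carrier R \<Longrightarrow> z [^] (m::nat) = \<one> \<Longrightarrow> z = \<one> \<or> z = \<ominus> \<one>"
    and n: "\<And>z. z \<in> carrier R \<Longrightarrow> z [^] (n::nat) = \<one> \<Longrightarrow> z = \<one> \<or> z = \<ominus> \<one>"
    and pos: "0 < m" "0 < n"
    and z: "z \<in> carrier R" "z [^] lcm m n = \<one>"
  shows "z = \<one> \<or> z = \<ominus> \<one>"
proof -
  define m' n' where "m' = m div gcd m n" and "n' = n div gcd m n"
  have copr: "coprime n' m'"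
    using div_gcd_coprime[of m n] pos by (simp add: m'_def n'_def coprime_commute)
  have lcm: "lcm m n = n' * m" "lcm m n = m' * n"
    by (simp_all add: lcm_nat_def m'_def n'_def div_mult_swap mult.commute)
  have sq: "(y [^] (2::nat)) = \<one>" if "y = \<one> \<or> y = \<ominus> \<one>" for y
    using that by (auto simp: numeral_2_eq_2 l_minus)
  have "(z [^] n') [^] m = \<one>" "(z [^] m') [^] n = \<one>"
    using z lcm by (simp_all add: nat_pow_pow)
  then have "(z [^] n') [^] (2::nat) = \<one>" "(z [^] m') [^] (2::nat) = \<one>"
    using m n sq z(1) by simp_all
  then have 1: "(z [^] (2::nat)) [^] n' = \<one>" "(z [^] (2::nat)) [^] m' = \<one>"
    using z(1) by (simp_all add: nat_pow_pow mult.commute)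
  \<comment> \<open>Bezout over the naturals, with \<open>n'\<close> nonzero, yields
    \<open>n' * x = m' * y + 1\<close>. Both powers of \<open>?w\<close> in this identity are
    \<open>\<one>\<close>, so \<open>?w = \<one>\<close>.\<close>
  have "n = gcd m n * n'" by (simp add: n'_def)
  then have "n' \<noteq> 0" using pos by (metis mult_0_right not_gr_zero)
  then obtain x y where xy: "n' * x = m' * y + 1"
    using bezout_nat[of n' m'] copr by auto
  let ?w = "z [^] (2::nat)"
  have "?w [^] (n' * x) = ?w [^] (m' * y) \<otimes> ?w" unfolding xy using z(1) by (simp add: nat_pow_mult[symmetric])
  moreover have "?w [^] (n' * x) = (?w [^] n') [^] x" "?w [^] (m' * y) = (?w [^] m') [^] y"
    using z(1) by (simp_all add: nat_pow_pow mult.assoc)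
  ultimately have "?w = \<one>" using 1 z(1) by simp
  then show ?thesis using square_eq_one z(1) by blast
qed

section \<open>Characteristic\<close>

lemma (in ring) ring_char_dvd:
  assumes "[n] \<cdot> \<one> = \<zero>" and "0 < (n::nat)"
  shows "0 < ring_char R" and "ring_char R dvd n" and "[(ring_char R)] \<cdot> \<one> = \<zero>"
proof -
  let ?P = "\<lambda>n::nat. 0 < n \<and> [n] \<cdot> \<one> = \<zero>"
  have ex: "\<exists>n. ?P n" using assms by blast
  then have p: "ring_char R = (LEAST n. ?P n)" unfolding ring_char_def by simp
  have P: "?P (ring_char R)" unfolding p by (rule LeastI_ex[OF ex])
  then show "0 < ring_char R" and "[(ring_char R)] \<cdot> \<one> = \<zero>" by simp_all
  show "ring_char R dvd n"
  proof (rule ccontr)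
    assume "\<not> ring_char R dvd n"
    then have r: "0 < n mod ring_char R" by (simp add: dvd_eq_mod_eq_0)
    \<comment> \<open>The multiple of \<open>\<one>\<close> by the remainder vanishes as well,
      against the minimality of the characteristic.\<close>
    have "[n] \<cdot> \<one> = ([(n div ring_char R)] \<cdot> ([(ring_char R)] \<cdot> \<one>)) \<oplus> ([(n mod ring_char R)] \<cdot> \<one>)"
      by (simp add: add.nat_pow_pow add.nat_pow_mult mult.commute)
    then have "[(n mod ring_char R)] \<cdot> \<one> = \<zero>" using assms(1) P by simp
    then have "ring_char R \<le> n mod ring_char R" unfolding p using r by (intro Least_le) (simp add: p)
    then show False using P by (simp add: not_less[symmetric])
  qed
qed

lemma add_pow_subring:
  fixes n :: nat
  shows "[n] \<cdot>\<^bsub>R\<lparr>carrier := K\<rparr>\<^esub> a = [n] \<cdot>\<^bsub>R\<^esub> a"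
  by (simp add: add_pow_def nat_pow_def)

text \<open>Restricting the carrier changes neither addition nor zero nor one. So the condition in
  \<open>theta\<close> on the characteristic of \<open>K\<close> is one on the characteristic of the
  ambient field.\<close>

lemma ring_char_subring: "ring_char (R\<lparr>carrier := K\<rparr>) = ring_char R"
proof -
  have "([n] \<cdot>\<^bsub>R\<lparr>carrier := K\<rparr>\<^esub> \<one>\<^bsub>R\<lparr>carrier := K\<rparr>\<^esub> = \<zero>\<^bsub>R\<lparr>carrier := K\<rparr>\<^esub>)
      \<longleftrightarrow> ([n] \<cdot>\<^bsub>R\<^esub> \<one>\<^bsub>R\<^esub> = \<zero>\<^bsub>R\<^esub>)" for n :: nat
    by (simp add: add_pow_subring)
  then show ?thesis unfolding ring_char_def by (simp only:)
qed

section \<open>From linear relations to finite families\<close>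

lemma (in ring) combine_eq_finsum:
  assumes "length Ks = length Us" and "set Ks \<subseteq> carrier R" and "set Us \<subseteq> carrier R"
  shows "combine Ks Us = (\<Oplus>i\<in>{..<length Us}. Ks ! i \<otimes> Us ! i)"
  using assms
proof (induction Ks Us rule: list_induct2)
  case Nil
  then show ?case by simp
next
  case (Cons k Ks u Us)
  have "(\<Oplus>i\<in>{..<Suc (length Us)}. (k # Ks) ! i \<otimes> (u # Us) ! i)
      = (\<Oplus>i\<in>insert 0 (Suc ` {..<length Us}). (k # Ks) ! i \<otimes> (u # Us) ! i)"
    by (simp add: lessThan_Suc_eq_insert_0)
  also have "\<dots> = k \<otimes> u \<oplus> (\<Oplus>i\<in>Suc ` {..<length Us}. (k # Ks) ! i \<otimes> (u # Us) ! i)"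
    using Cons by (subst finsum_insert) (auto simp: subset_iff)
  also have "(\<Oplus>i\<in>Suc ` {..<length Us}. (k # Ks) ! i \<otimes> (u # Us) ! i)
      = (\<Oplus>i\<in>{..<length Us}. Ks ! i \<otimes> Us ! i)"
    using Cons by (subst finsum_reindex) (auto simp: subset_iff)
  finally show ?case using Cons by simp
qed

text \<open>Independence of the list keeps \<open>a\<close> out of the span of \<open>b\<close>,
  which contains zero and every \<open>K\<close>-multiple of \<open>b\<close>.\<close>

lemma (in field) pair_independentD:
  assumes K: "subfield K R" and "independent K [a, b]"
  shows "a \<in> carrier R" and "a \<noteq> \<zero>" and "k \<in> K \<Longrightarrow> a \<noteq> k \<otimes> b"
proof -
  show "a \<in> carrier R" using independent_backwards(3)[OF assms(2)] .
  have aS: "a \<notin> Span K [b]" using independent_backwards(1)[OF assms(2)] .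
  have sub: "set [b] \<subseteq> carrier R"
    using independent_in_carrier[OF independent_backwards(2)[OF assms(2)]] .
  show "a \<noteq> \<zero>" using aS Span_subgroup_props(2)[OF K sub] by metis
  show "a \<noteq> k \<otimes> b" if "k \<in> K"
    using aS that Span_smult_closed[OF K sub that] Span_base_incl[OF K sub] by auto
qed

lemma (in field) thetaD:
  assumes K: "subfield K R" and A: "A \<in> theta K R"
  shows "\<And>a. a \<in> A \<Longrightarrow> a \<in> carrier R \<and> a \<noteq> \<zero>"
    and "\<And>a. a \<in> A \<Longrightarrow> 0 < min_exp K R a \<and> a [^] min_exp K R a \<in> K"
    and "\<And>a b k. a \<in> A \<Longrightarrow> b \<in> A \<Longrightarrow> a \<noteq> b \<Longrightarrow> k \<in> K \<Longrightarrow> a \<noteq> k \<otimes> b"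
    and "\<And>a. a \<in> A \<Longrightarrow> 0 < ring_char R \<Longrightarrow> coprime (min_exp K R a) (ring_char R)"
proof -
  have pair: "independent K [a, b]" if "a \<in> A" "b \<in> A" "a \<noteq> b" for a b
  proof -
    have "lin_indep K R {a, b}" using A that by (simp add: theta_def)
    then have "distinct [a, b] \<and> set [a, b] \<subseteq> {a, b} \<longrightarrow> independent K [a, b]"
      unfolding lin_indep_def by blast
    then show ?thesis using that(3) by simp
  qed
  show "a \<in> carrier R \<and> a \<noteq> \<zero>" if a: "a \<in> A" for a
  proof -
    \<comment> \<open>Having at least two elements in \<open>A\<close> supplies a partner for
      \<open>a\<close>; independence of that pair excludes \<open>a = \<zero>\<close>.\<close>
    have "\<exists>b\<in>A. b \<noteq> a"
    proof (rule ccontr)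
      assume "\<not> (\<exists>b\<in>A. b \<noteq> a)"
      then have "A = {a}" using a by blast
      then show False using A by (simp add: theta_def)
    qed
    then obtain b where "b \<in> A" "b \<noteq> a" by blast
    then show ?thesis using pair_independentD(1,2)[OF K pair[OF a]] by blast
  qed
  show "0 < min_exp K R a \<and> a [^] min_exp K R a \<in> K" if "a \<in> A" for a
  proof -
    have "\<exists>n::nat. 0 < n \<and> a [^] n \<in> K" using A that by (simp add: theta_def)
    then show ?thesis unfolding min_exp_def by (rule LeastI_ex)
  qed
  show "a \<noteq> k \<otimes> b" if "a \<in> A" "b \<in> A" "a \<noteq> b" "k \<in> K" for a b k
    using pair_independentD(3)[OF K pair[OF that(1-3)] that(4)] .
  show "coprime (min_exp K R a) (ring_char R)" if "a \<in> A" "0 < ring_char R" for a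
    using A that by (simp add: theta_def ring_char_subring coprime_iff_gcd_eq_1)
qed

text \<open>Positivity, coprimality to the characteristic and triviality of the roots of unity all
  pass to least common multiples, so they can be accumulated over the finite set.\<close>

lemma (in field) common_exponent:
  assumes "finite S" and "\<And>a. a \<in> S \<Longrightarrow> 0 < (e a :: nat)"
    and "\<And>a. a \<in> S \<Longrightarrow> 0 < ring_char R \<Longrightarrow> coprime (e a) (ring_char R)"
    and "\<And>a z. a \<in> S \<Longrightarrow> z \<in> carrier R \<Longrightarrow> z [^] e a = \<one> \<Longrightarrow> z = \<one> \<or> z = \<ominus> \<one>"
  obtains N where "0 < N" and "\<And>a. a \<in> S \<Longrightarrow> e a dvd N" and "[N] \<cdot> \<one> \<noteq> \<zero>"
    and "\<And>z. z \<in> carrier R \<Longrightarrow> z [^] N = \<one> \<Longrightarrow> z = \<one> \<or> z = \<ominus> \<one>"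
proof -
  \<comment> \<open>Coprimality is demanded only in positive characteristic, since being coprime to
    0 would mean \<open>n = 1\<close>.\<close>
  define good where "good n \<longleftrightarrow> 0 < n \<and> (0 < ring_char R \<longrightarrow> coprime n (ring_char R)) \<and>
    (\<forall>z\<in>carrier R. z [^] n = \<one> \<longrightarrow> z = \<one> \<or> z = \<ominus> \<one>)" for n :: nat
  have good_lcm: "good (lcm m n)" if mn: "good m" "good n" for m n
    unfolding good_def
  proof (intro conjI impI ballI)
    have pos: "0 < m" "0 < n" using mn by (simp_all add: good_def)
    then show "0 < lcm m n" by (simp add: lcm_pos_nat)
    show "coprime (lcm m n) (ring_char R)" if "0 < ring_char R"
    proof (rule coprime_divisors[of _ "m * n" _ "ring_char R"])
      show "lcm m n dvd m * n" by (simp add: lcm_least)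
      show "coprime (m * n) (ring_char R)" using mn that by (simp add: good_def)
    qed simp
    show "z = \<one> \<or> z = \<ominus> \<one>" if z: "z \<in> carrier R" "z [^] lcm m n = \<one>" for z
      by (rule trivial_roots_of_unity_lcm[OF _ _ pos z]) (use mn in \<open>auto simp: good_def\<close>)
  qed
  have good_e: "good (e a)" if "a \<in> S" for a
    unfolding good_def using assms(2-4)[OF that] by simp
  from assms(1) good_e have "\<exists>N. good N \<and> (\<forall>a\<in>S. e a dvd N)"
  proof (induction S rule: finite_induct)
    case empty
    show ?case by (intro exI[of _ 1]) (simp add: good_def)
  next
    case (insert a S)
    then obtain N where N: "good N" "\<forall>a\<in>S. e a dvd N" by auto
    show ?case
    proof (intro exI[of _ "lcm N (e a)"] conjI ballI)
      show "good (lcm N (e a))" using good_lcm[OF N(1)] insert.prems by simp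
      show "e b dvd lcm N (e a)" if "b \<in> insert a S" for b
        using that N(2) by (auto intro: dvd_lcmI1)
    qed
  qed
  then obtain N where "good N" and dvd: "\<forall>a\<in>S. e a dvd N" by blast
  then have N: "0 < N" "0 < ring_char R \<longrightarrow> coprime N (ring_char R)"
    "\<And>z. z \<in> carrier R \<Longrightarrow> z [^] N = \<one> \<Longrightarrow> z = \<one> \<or> z = \<ominus> \<one>"
    by (auto simp: good_def)
  \<comment> \<open>Otherwise the characteristic would be positive, divide \<open>N\<close> and be
    coprime to it, hence equal 1, giving \<open>\<one> = \<zero>\<close>.\<close>
  have "[N] \<cdot> \<one> \<noteq> \<zero>"
  proof
    assume N0: "[N] \<cdot> \<one> = \<zero>"
    note c = ring_char_dvd[OF N0 N(1)]
    have "coprime N (ring_char R)" using N(2) c(1) by blast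
    then have "ring_char R = 1" using c(2) coprime_common_divisor[of N "ring_char R"] by simp
    with c(3) show False by simp
  qed
  then show ?thesis using that[of N] N dvd by simp
qed

theorem theorem2:
  fixes L :: "('a, 'b) ring_scheme" (structure) and K A :: "'a set"
  assumes "field L" and "subfield K L" and "A \<in> theta K L"
    and "\<And>a z. a \<in> A \<Longrightarrow> z \<in> carrier L \<Longrightarrow> z [^] min_exp K L a = \<one> \<Longrightarrow> z = \<one> \<or> z = \<ominus> \<one>"
  shows "lin_indep K L A"
proof -
  interpret field L by (rule assms(1))
  note K = assms(2) and A = thetaD[OF assms(2,3)] and sub = subringE[OF subfieldE(1)[OF assms(2)]]
  have "independent K Us" if Us: "distinct Us" "set Us \<subseteq> A" for Us
  proof (rule ccontr)
    assume "dependent K Us"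
    moreover have UsR: "set Us \<subseteq> carrier L" using Us(2) A(1) by blast
    ultimately obtain Ks where Ks: "length Ks = length Us" "combine Ks Us = \<zero>" "set Ks \<subseteq> K"
        "set Ks \<noteq> {\<zero>}"
      using dependent_imp_non_trivial_combine[OF K] by metis
    \<comment> \<open>The condition \<open>set Ks \<noteq> {\<zero>}\<close> also holds for the
      empty list, which must be excluded to obtain a nonzero coefficient.\<close>
    have "Us \<noteq> []" using \<open>dependent K Us\<close> by auto
    then have "set Ks \<noteq> {}" using Ks(1) by auto
    then have "\<not> set Ks \<subseteq> {\<zero>}" using Ks(4) subset_singletonD by metis
    then obtain k where "k \<in> set Ks" "k \<noteq> \<zero>" by blast
    then obtain i0 where i0: "i0 < length Us" "Ks ! i0 \<noteq> \<zero>"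
      using Ks(1) by (metis in_set_conv_nth)
    \<comment> \<open>The set \<open>A\<close> may be infinite; a common exponent is taken only for
      the finitely many elements of the relation.\<close>
    obtain N where N: "0 < N" "\<And>a. a \<in> set Us \<Longrightarrow> min_exp K L a dvd N" "[N] \<cdot> \<one> \<noteq> \<zero>"
      "\<And>z. z \<in> carrier L \<Longrightarrow> z [^] N = \<one> \<Longrightarrow> z = \<one> \<or> z = \<ominus> \<one>"
    proof (rule common_exponent[of "set Us" "min_exp K L"])
      show "0 < min_exp K L a" if "a \<in> set Us" for a using A(2) Us(2) that by blast
      show "coprime (min_exp K L a) (ring_char L)" if "a \<in> set Us" "0 < ring_char L" for a
        using A(4) Us(2) that by blast
      show "z = \<one> \<or> z = \<ominus> \<one>"
        if "a \<in> set Us" "z \<in> carrier L" "z [^] min_exp K L a = \<one>" for a z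
        using assms(4)[OF _ that(2,3)] Us(2) that(1) by blast
    qed auto
    \<comment> \<open>Terms with zero coefficient are dropped, and the remaining coefficients are
      absorbed into the terms \<open>f i\<close>.\<close>
    define I where "I = {i. i < length Us \<and> Ks ! i \<noteq> \<zero>}"
    define f where "f i = Ks ! i \<otimes> Us ! i" for i
    have KsK: "Ks ! i \<in> K" "Ks ! i \<in> carrier L" if "i < length Us" for i
      using Ks(1,3) that sub(1) by (auto simp: subset_iff)
    have UsA: "Us ! i \<in> A" "Us ! i \<in> carrier L" "Us ! i \<noteq> \<zero>" if "i < length Us" for i
      using Us(2) A(1) that by (auto simp: subset_iff)
    have UsN: "(Us ! i) [^] N \<in> K" if i: "i < length Us" for i
    proof -
      obtain m where m: "N = min_exp K L (Us ! i) * m" using N(2)[of "Us ! i"] i by auto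
      have "((Us ! i) [^] min_exp K L (Us ! i)) [^] m \<in> K"
        by (induction m) (use A(2)[OF UsA(1)[OF i]] sub(3,6) in auto)
      then show ?thesis using m UsA(2)[OF i] by (simp add: nat_pow_pow)
    qed
    \<comment> \<open>Nonzero coefficients are invertible in \<open>K\<close>, so proportional terms
      come from proportional elements of \<open>A\<close>. The case \<open>k = \<one>\<close> gives
      injectivity of \<open>f\<close>, the general case the condition on quotients.\<close>
    have ratio: "i = j" if ij: "i \<in> I" "j \<in> I" and k: "k \<in> K" "f i = k \<otimes> f j" for i j k
    proof (rule ccontr)
      assume "i \<noteq> j"
      have lt: "i < length Us" "j < length Us" and nz: "Ks ! i \<noteq> \<zero>" using ij by (auto simp: I_def)
      have "Us ! i \<noteq> Us ! j" using Us(1) lt \<open>i \<noteq> j\<close> nth_eq_iff_index_eq by blast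
      note inv = inv_closed_nonzero[OF KsK(2)[OF lt(1)] nz]
      have kR: "k \<in> carrier L" using k(1) sub(1) by blast
      have "inv (Ks ! i) \<otimes> f i = Us ! i"
        unfolding f_def using inv KsK(2) UsA(2) lt by (simp add: m_assoc[symmetric])
      then have "Us ! i = inv (Ks ! i) \<otimes> (k \<otimes> (Ks ! j \<otimes> Us ! j))" using k(2) by (simp add: f_def)
      also have "\<dots> = (inv (Ks ! i) \<otimes> k \<otimes> Ks ! j) \<otimes> Us ! j"
        using inv(1) kR KsK(2) UsA(2) lt by (simp add: m_assoc)
      finally have "Us ! i = (inv (Ks ! i) \<otimes> k \<otimes> Ks ! j) \<otimes> Us ! j" .
      moreover have "inv (Ks ! i) \<otimes> k \<otimes> Ks ! j \<in> K"
        using subfield_inv_mem[OF K KsK(1)[OF lt(1)] nz] k(1) KsK(1)[OF lt(2)] sub(6) by simp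
      ultimately show False using A(3)[OF UsA(1) UsA(1) \<open>Us ! i \<noteq> Us ! j\<close>] lt by blast
    qed
    have fR: "f i \<in> carrier L" "f i \<noteq> \<zero>" if "i \<in> I" for i
      using that KsK(2) UsA integral_iff by (auto simp: f_def I_def)
    have inj: "inj_on f I"
      by (rule inj_onI) (use ratio[of _ _ \<one>] sub(3) fR in auto)
    have "radical_family N K (f ` I)"
      unfolding radical_family_def
    proof (intro conjI ballI impI)
      show "finite (f ` I)" by (simp add: I_def)
      show "f ` I \<subseteq> carrier L - {\<zero>}" using fR by auto
    next
      fix y assume "y \<in> f ` I"
      then obtain i where i: "i < length Us" "y = f i" by (auto simp: I_def)
      have "(Ks ! i) [^] N \<in> K" by (induction N) (use KsK(1)[OF i(1)] sub(3,6) in auto)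
      moreover have "y [^] N = (Ks ! i) [^] N \<otimes> (Us ! i) [^] N"
        unfolding i(2) f_def using KsK(2) UsA(2) i(1) by (intro nat_pow_distrib) auto
      ultimately show "y [^] N \<in> K" using UsN[OF i(1)] sub(6) by simp
    next
      fix y z assume "y \<in> f ` I" "z \<in> f ` I" "y \<noteq> z"
      then obtain i j where ij: "i \<in> I" "j \<in> I" "y = f i" "z = f j" "i \<noteq> j" by blast
      show "y \<otimes> inv z \<notin> K"
      proof
        assume "y \<otimes> inv z \<in> K"
        moreover have "y = (y \<otimes> inv z) \<otimes> z"
          using div_cancel_nonzero[of y z \<one>] fR ij by simp
        ultimately show False using ratio ij by metis
      qed
    qed
    moreover have "f ` I \<noteq> {}" using i0 by (auto simp: I_def)
    ultimately have "(\<Oplus>x\<in>f ` I. x) \<noteq> \<zero>"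
      using radical_family_sum_nonzero[OF N(1,3,4) K] by blast
    moreover have "(\<Oplus>x\<in>f ` I. x) = (\<Oplus>i\<in>I. f i)"
      by (rule finsum_reindex[OF _ inj]) (use fR in auto)
    moreover have "(\<Oplus>i\<in>I. f i) = (\<Oplus>i\<in>{..<length Us}. f i)"
      using KsK(2) UsA(2) by (intro add.finprod_mono_neutral_cong_left) (auto simp: I_def f_def)
    moreover have "\<dots> = \<zero>"
      using combine_eq_finsum[OF Ks(1) _ UsR] Ks(2,3) sub(1) by (simp add: f_def subset_iff)
    ultimately show False by simp
  qed
  then show ?thesis unfolding lin_indep_def by blast
qed

end
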